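(* There exists a Hausdorff, first-countable topological space that is SL but is not selectively star-ccc. Moreover, there exists a Hausdorff, first-countable topological space that is $2$-SL, is not selectively $2$-star-ccc, and does not have the DCCC.
   Context: For an open cover $\mathcal{U}$ of a space $X$ and $A\subset X$, put $\operatorname{st}^1(A,\mathcal{U})=\bigcup\{U\in\mathcal{U}:U\cap A\neq\emptyset\}$ and inductively $\operatorname{st}^{n+1}(A,\mathcal{U})=\bigcup\{U\in\mathcal{U}:U\cap \operatorname{st}^n(A,\mathcal{U})\neq\emptyset\}$. A space $X$ has the discrete countable chain condition (DCCC) if there is no uncountable discrete family of nonempty open subsets of $X$ (a family is discrete if every point of $X$ has a neighbourhood meeting at most one member of the family). For a positive integer $k$, $X$ is $k$-SL ($k$-star-Lindelöf) if for every open cover $\mathcal{U}$ of $X$ there is a countable $\mathcal{U}'\subset\mathcal{U}$ with $\operatorname{st}^k(\bigcup\mathcal{U}',\mathcal{U})=X$; SL means $1$-SL. For a positive integer $k$, $X$ is selectively $k$-star-ccc if for every open cover $\mathcal{U}$ of $X$ and every sequence $(\mathcal{A}_n:n\in\omega)$ of maximal pairwise disjoint families of open subsets of $X$, there is a sequence $(A_n:n\in\omega)$ with $A_n\in\mathcal{A}_n$ for all $n$ such that $\operatorname{st}^k(\bigcup_{n\in\omega}A_n,\mathcal{U})=X$. Selectively star-ccc means selectively $1$-star-ccc. The members of a maximal pairwise disjoint family of open sets are taken to be nonempty. *)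

theory Defs
  imports "HOL-Analysis.Analysis"
begin

definition open_cover :: "'a topology \<Rightarrow> 'a set set \<Rightarrow> bool" where
  "open_cover X \<U> \<longleftrightarrow> (\<forall>U\<in>\<U>. openin X U) \<and> \<Union>\<U> = topspace X"

definition star :: "'a set \<Rightarrow> 'a set set \<Rightarrow> 'a set" where
  "star A \<U> = \<Union>{U \<in> \<U>. U \<inter> A \<noteq> {}}"

(* The value at 0 is only the starting point of the recursion, making
   iter_star (Suc 0) = star; all notions below are meant for positive k. *)
primrec iter_star :: "nat \<Rightarrow> 'a set \<Rightarrow> 'a set set \<Rightarrow> 'a set" where
  "iter_star 0 A \<U> = A"
| "iter_star (Suc n) A \<U> = star (iter_star n A \<U>) \<U>"

definition discrete_family :: "'a topology \<Rightarrow> 'a set set \<Rightarrow> bool" where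
  "discrete_family X \<F> \<longleftrightarrow>
     (\<forall>x\<in>topspace X. \<exists>V. openin X V \<and> x \<in> V \<and>
        (\<forall>A\<in>\<F>. \<forall>B\<in>\<F>. V \<inter> A \<noteq> {} \<and> V \<inter> B \<noteq> {} \<longrightarrow> A = B))"

definition DCCC :: "'a topology \<Rightarrow> bool" where
  "DCCC X \<longleftrightarrow>
     \<not> (\<exists>\<F>. uncountable \<F> \<and> (\<forall>A\<in>\<F>. openin X A \<and> A \<noteq> {}) \<and> discrete_family X \<F>)"

definition star_Lindelof :: "nat \<Rightarrow> 'a topology \<Rightarrow> bool" where
  "star_Lindelof k X \<longleftrightarrow>
     (\<forall>\<U>. open_cover X \<U> \<longrightarrow>
        (\<exists>\<V>. countable \<V> \<and> \<V> \<subseteq> \<U> \<and> iter_star k (\<Union>\<V>) \<U> = topspace X))"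

definition disjoint_open_family :: "'a topology \<Rightarrow> 'a set set \<Rightarrow> bool" where
  "disjoint_open_family X \<A> \<longleftrightarrow>
     (\<forall>A\<in>\<A>. openin X A \<and> A \<noteq> {}) \<and> pairwise disjnt \<A>"

definition maximal_disjoint_open_family :: "'a topology \<Rightarrow> 'a set set \<Rightarrow> bool" where
  "maximal_disjoint_open_family X \<A> \<longleftrightarrow>
     disjoint_open_family X \<A> \<and>
     (\<forall>\<B>. disjoint_open_family X \<B> \<and> \<A> \<subseteq> \<B> \<longrightarrow> \<B> = \<A>)"

definition selectively_star_ccc :: "nat \<Rightarrow> 'a topology \<Rightarrow> bool" where
  "selectively_star_ccc k X \<longleftrightarrow>
     (\<forall>\<U> (\<A> :: nat \<Rightarrow> 'a set set).
        open_cover X \<U> \<and> (\<forall>n. maximal_disjoint_open_family X (\<A> n)) \<longrightarrow>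
        (\<exists>A. (\<forall>n. A n \<in> \<A> n) \<and> iter_star k (\<Union>n. A n) \<U> = topspace X))"

end

(* Both spaces rest on the Pixley-Roy space of the real line: its points are the nonempty finite
   sets F of reals, with neighbourhoods [F,U] = {G. F \<subseteq> G \<subseteq> U} for U open.  Two sets [F,W] and [G,W]
   with the same W meet in F \<union> G, and W may be taken from a countable family, so countably many
   members of any cover have a union meeting every member: the space is SL.  Take for the n-th
   maximal disjoint family sets [F,U] with U of measure at most 2^-(n+1).  A selection then misses
   some real x entirely, so it is disjoint from [{x},UNIV], which is the only member of the cover
   {[{y},UNIV] | y real} containing the point {x}.

   For the second space, take countably many copies of the Pixley-Roy space and, for each real x,
   a copy of the real line whose rationals form an open set with their usual topology.  A
   neighbourhood of an irrational r of the x-th line consists of r, the rationals near r, and the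
   sets [{x},UNIV] in almost all of the copies numbered by a sequence depending on (x,r); these
   sequences are almost disjoint, which makes the space Hausdorff.  The sets of rationals on the
   lines form an uncountable discrete family.  Two stars reach everything: the first one reaches
   the irrationals from the Pixley-Roy part, the second one the rationals from nearby irrationals.
   The neighbourhoods of the irrationals can be chosen to avoid 0, and then a selection
   missing x needs one star more to reach the point 0 of that line. *)
theory Submission
  imports Defs
begin

section \<open>Maximal disjoint families\<close>

text \<open>A nonempty open set missing every member could be added, so maximality says that the
  union of the family is dense. Conversely, by density an extra member of a larger disjoint family
  would overlap an old one.\<close>

lemma maximal_disjoint_open_family_iff:
  "maximal_disjoint_open_family X \<A> \<longleftrightarrow>
     disjoint_open_family X \<A> \<and> (\<forall>V. openin X V \<and> V \<noteq> {} \<longrightarrow> (\<exists>A\<in>\<A>. A \<inter> V \<noteq> {}))"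
proof (intro iffI conjI allI impI)
  assume max: "maximal_disjoint_open_family X \<A>"
  then show disj: "disjoint_open_family X \<A>"
    by (simp add: maximal_disjoint_open_family_def)
  fix V assume V: "openin X V \<and> V \<noteq> {}"
  show "\<exists>A\<in>\<A>. A \<inter> V \<noteq> {}"
  proof (rule ccontr)
    assume neg: "\<not> (\<exists>A\<in>\<A>. A \<inter> V \<noteq> {})"
    then have "disjoint_open_family X (insert V \<A>)"
      using disj V by (auto simp: disjoint_open_family_def pairwise_insert disjnt_def)
    then have "insert V \<A> = \<A>"
      using max unfolding maximal_disjoint_open_family_def by blast
    then show False using neg V by blast
  qed
next
  assume *: "disjoint_open_family X \<A> \<and> (\<forall>V. openin X V \<and> V \<noteq> {} \<longrightarrow> (\<exists>A\<in>\<A>. A \<inter> V \<noteq> {}))"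
  have "\<B> = \<A>" if \<B>: "disjoint_open_family X \<B>" "\<A> \<subseteq> \<B>" for \<B>
  proof (intro equalityI subsetI)
    fix B assume B: "B \<in> \<B>"
    then have "openin X B" "B \<noteq> {}"
      using \<B>(1) by (auto simp: disjoint_open_family_def)
    then obtain A where "A \<in> \<A>" "A \<inter> B \<noteq> {}"
      using * by blast
    then show "B \<in> \<A>"
      using \<B> B by (metis (no_types) disjnt_def disjoint_open_family_def pairwiseD subsetD)
  qed (use \<B> in blast)
  with * show "maximal_disjoint_open_family X \<A>"
    by (simp add: maximal_disjoint_open_family_def)
qed

text \<open>Zorn's lemma is applied only to disjoint families whose members all satisfy
  \<open>P\<close>. A maximal one is maximal among all disjoint families: an open set missing it
  would contain a nonempty open set with \<open>P\<close>, which could still be added.\<close>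

lemma exists_maximal_disjoint_open_family:
  assumes P: "\<And>V. openin X V \<Longrightarrow> V \<noteq> {} \<Longrightarrow> \<exists>W\<subseteq>V. openin X W \<and> W \<noteq> {} \<and> P W"
  shows "\<exists>\<A>. maximal_disjoint_open_family X \<A> \<and> (\<forall>A\<in>\<A>. P A)"
proof -
  define S where "S = {\<A>. disjoint_open_family X \<A> \<and> (\<forall>A\<in>\<A>. P A)}"
  have "\<exists>M\<in>S. \<forall>\<A>\<in>S. M \<subseteq> \<A> \<longrightarrow> \<A> = M"
  proof (rule subset_Zorn_nonempty)
    show "S \<noteq> {}"
      by (auto simp: S_def disjoint_open_family_def intro!: exI[of _ "{}"])
    fix \<C> assume "\<C> \<noteq> {}" and chain: "subset.chain S \<C>"
    then have "\<C> \<subseteq> S" and lin: "\<And>x y. x \<in> \<C> \<Longrightarrow> y \<in> \<C> \<Longrightarrow> x \<subseteq> y \<or> y \<subseteq> x"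
      by (auto simp: subset.chain_def)
    have "pairwise disjnt (\<Union>\<C>)"
      unfolding pairwise_def
    proof (intro ballI impI)
      fix A B assume "A \<in> \<Union>\<C>" "B \<in> \<Union>\<C>" "A \<noteq> B"
      then obtain \<D> where "\<D> \<in> \<C>" "A \<in> \<D>" "B \<in> \<D>"
        using lin by blast
      with \<open>\<C> \<subseteq> S\<close> \<open>A \<noteq> B\<close> show "disjnt A B"
        by (auto simp: S_def disjoint_open_family_def pairwise_def)
    qed
    with \<open>\<C> \<subseteq> S\<close> show "\<Union>\<C> \<in> S"
      unfolding S_def disjoint_open_family_def by blast
  qed
  then obtain M where M: "M \<in> S" and max: "\<And>\<A>. \<A> \<in> S \<Longrightarrow> M \<subseteq> \<A> \<Longrightarrow> \<A> = M"
    by blast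
  have "\<exists>A\<in>M. A \<inter> V \<noteq> {}" if V: "openin X V" "V \<noteq> {}" for V
  proof (rule ccontr)
    assume neg: "\<not> (\<exists>A\<in>M. A \<inter> V \<noteq> {})"
    obtain W where W: "W \<subseteq> V" "openin X W" "W \<noteq> {}" "P W"
      using P V by blast
    with neg M have "insert W M \<in> S"
      by (auto simp: S_def disjoint_open_family_def pairwise_insert disjnt_def)
    then have "insert W M = M"
      using max by blast
    then show False using neg W by blast
  qed
  with M show ?thesis
    by (auto simp: maximal_disjoint_open_family_iff S_def)
qed

section \<open>Homeomorphism invariance\<close>

text \<open>Injectivity on a set containing everything involved makes images meet exactly when the
  originals do. The invariance results serve to move each space from the type on which it is built
  to \<open>nat \<Rightarrow> real\<close>.\<close>

lemma star_image:
  assumes "inj_on f S" "\<And>U. U \<in> \<U> \<Longrightarrow> U \<subseteq> S" "A \<subseteq> S"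
  shows "star (f ` A) ((`) f ` \<U>) = f ` star A \<U>"
proof -
  have "f ` U \<inter> f ` A \<noteq> {} \<longleftrightarrow> U \<inter> A \<noteq> {}" if "U \<in> \<U>" for U
    using assms that by (metis image_is_empty inj_on_image_Int)
  then show ?thesis
    unfolding star_def by blast
qed

lemma iter_star_image:
  assumes "inj_on f S" "\<And>U. U \<in> \<U> \<Longrightarrow> U \<subseteq> S" "A \<subseteq> S"
  shows "iter_star k A \<U> \<subseteq> S \<and> iter_star k (f ` A) ((`) f ` \<U>) = f ` iter_star k A \<U>"
proof (induction k)
  case (Suc k)
  moreover have "star (iter_star k A \<U>) \<U> \<subseteq> S"
    using assms(2) by (auto simp: star_def)
  ultimately show ?case
    using star_image[OF assms(1,2)] by simp
qed (use assms in simp)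

lemma open_cover_homeomorphic_image:
  assumes "homeomorphic_map X Y f" "open_cover X \<U>"
  shows "open_cover Y ((`) f ` \<U>)"
proof -
  have "\<Union>((`) f ` \<U>) = f ` \<Union>\<U>"
    by blast
  with assms show ?thesis
    by (auto simp: open_cover_def homeomorphic_imp_surjective_map
        homeomorphic_map_openness_eq)
qed

lemma openin_homeomorphic_image:
  assumes "homeomorphic_map X Y f" "openin X U"
  shows "openin Y (f ` U)"
  using assms by (auto simp: homeomorphic_map_openness_eq)

lemma maximal_disjoint_open_family_homeomorphic_image:
  assumes f: "homeomorphic_map X Y f" and "maximal_disjoint_open_family X \<A>"
  shows "maximal_disjoint_open_family Y ((`) f ` \<A>)"
proof -
  have inj: "inj_on f (topspace X)" and surj: "f ` topspace X = topspace Y"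
    using f by (auto simp: homeomorphic_eq_everything_map)
  have \<A>: "\<And>A. A \<in> \<A> \<Longrightarrow> openin X A \<and> A \<noteq> {} \<and> A \<subseteq> topspace X" "pairwise disjnt \<A>"
    and meet: "\<And>V. openin X V \<Longrightarrow> V \<noteq> {} \<Longrightarrow> \<exists>A\<in>\<A>. A \<inter> V \<noteq> {}"
    using assms(2) openin_subset
    by (auto simp: maximal_disjoint_open_family_iff disjoint_open_family_def)
  have "disjoint_open_family Y ((`) f ` \<A>)"
    unfolding disjoint_open_family_def
  proof
    show "\<forall>A\<in>(`) f ` \<A>. openin Y A \<and> A \<noteq> {}"
      using \<A>(1) openin_homeomorphic_image[OF f] by auto
    show "pairwise disjnt ((`) f ` \<A>)"
      unfolding pairwise_image
    proof (rule pairwiseI, rule impI)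
      fix A B assume "A \<in> \<A>" "B \<in> \<A>" "A \<noteq> B"
      with \<A> have "A \<inter> B = {}" "A \<subseteq> topspace X" "B \<subseteq> topspace X"
        by (auto simp: pairwise_def disjnt_def)
      then show "disjnt (f ` A) (f ` B)"
        using inj by (metis disjnt_def image_empty inj_on_image_Int)
    qed
  qed
  moreover have "\<exists>A\<in>(`) f ` \<A>. A \<inter> V \<noteq> {}" if V: "openin Y V" "V \<noteq> {}" for V
  proof -
    have "openin X {x \<in> topspace X. f x \<in> V}"
      using V(1) homeomorphic_imp_continuous_map[OF f] openin_continuous_map_preimage by blast
    moreover have "V \<subseteq> f ` topspace X"
      using surj openin_subset[OF V(1)] by simp
    then have "{x \<in> topspace X. f x \<in> V} \<noteq> {}"
      using V(2) by auto
    ultimately obtain A where "A \<in> \<A>" "A \<inter> {x \<in> topspace X. f x \<in> V} \<noteq> {}"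
      using meet by blast
    then show ?thesis by auto
  qed
  ultimately show ?thesis
    by (simp add: maximal_disjoint_open_family_iff)
qed

text \<open>The cover of \<open>Y\<close> is pulled to \<open>X\<close> by \<open>g\<close>, the
  countable subfamily is chosen there and pushed back by \<open>f\<close>. Since \<open>f\<close> g
  \<open>U = U\<close>, the result consists of members of the original cover.\<close>

lemma star_Lindelof_homeomorphic_space:
  assumes "X homeomorphic_space Y" "star_Lindelof k X"
  shows "star_Lindelof k Y"
  unfolding star_Lindelof_def
proof (intro allI impI)
  fix \<U> assume \<U>: "open_cover Y \<U>"
  obtain f g where fg: "homeomorphic_maps X Y f g"
    using assms(1) by (auto simp: homeomorphic_space_def)
  then have f: "homeomorphic_map X Y f" and g: "homeomorphic_map Y X g"
    by (auto simp: homeomorphic_maps_map)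
  have fgid: "f ` g ` U = U" if "U \<subseteq> topspace Y" for U
    using fg that by (force simp: homeomorphic_maps_def image_image)
  obtain \<V> where \<V>: "countable \<V>" "\<V> \<subseteq> (`) g ` \<U>"
    "iter_star k (\<Union>\<V>) ((`) g ` \<U>) = topspace X"
    using assms(2)[unfolded star_Lindelof_def, rule_format,
        OF open_cover_homeomorphic_image[OF g \<U>]] by blast
  have sub: "\<And>U. U \<in> \<U> \<Longrightarrow> U \<subseteq> topspace Y"
    using \<U> by (auto simp: open_cover_def)
  have gsub: "U \<subseteq> topspace X" if "U \<in> (`) g ` \<U>" for U
    using that sub homeomorphic_imp_surjective_map[OF g] by blast
  have im: "(`) f ` (`) g ` \<U> = \<U>"
    unfolding image_image[where f = "(`) f"] using fgid sub by simp
  have "iter_star k (f ` \<Union>\<V>) ((`) f ` (`) g ` \<U>) = f ` topspace X"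
  proof (subst iter_star_image[THEN conjunct2])
    show "inj_on f (topspace X)"
      using f by (auto simp: homeomorphic_eq_everything_map)
    show "\<Union>\<V> \<subseteq> topspace X"
      using \<V>(2) by (intro Union_least gsub) auto
  qed (use gsub \<V>(3) in auto)
  then have "iter_star k (\<Union>((`) f ` \<V>)) \<U> = topspace Y"
    using f im by (simp add: homeomorphic_imp_surjective_map image_Union)
  moreover have "(`) f ` \<V> \<subseteq> \<U>"
    using image_mono[OF \<V>(2), of "(`) f"] im by simp
  ultimately show "\<exists>\<V>. countable \<V> \<and> \<V> \<subseteq> \<U> \<and> iter_star k (\<Union>\<V>) \<U> = topspace Y"
    using \<V>(1) by (intro exI[of _ "(`) f ` \<V>"]) simp
qed

lemma selectively_star_ccc_homeomorphic_space:
  assumes "X homeomorphic_space Y" "selectively_star_ccc k X"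
  shows "selectively_star_ccc k Y"
  unfolding selectively_star_ccc_def
proof (intro allI impI)
  fix \<U> and \<A> :: "nat \<Rightarrow> 'b set set"
  assume *: "open_cover Y \<U> \<and> (\<forall>n. maximal_disjoint_open_family Y (\<A> n))"
  obtain f g where fg: "homeomorphic_maps X Y f g"
    using assms(1) by (auto simp: homeomorphic_space_def)
  then have f: "homeomorphic_map X Y f" and g: "homeomorphic_map Y X g"
    by (auto simp: homeomorphic_maps_map)
  have fgid: "f ` g ` U = U" if "U \<subseteq> topspace Y" for U
    using fg that by (force simp: homeomorphic_maps_def image_image)
  have sub: "\<And>U. U \<in> \<U> \<Longrightarrow> U \<subseteq> topspace Y"
    using * by (auto simp: open_cover_def)
  have subA: "\<And>n U. U \<in> \<A> n \<Longrightarrow> U \<subseteq> topspace Y"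
    using * openin_subset unfolding maximal_disjoint_open_family_def disjoint_open_family_def
    by meson
  have gsub: "g ` U \<subseteq> topspace X" if "U \<subseteq> topspace Y" for U
    using that homeomorphic_imp_surjective_map[OF g] by blast
  then have gsub': "\<And>U. U \<in> (`) g ` \<U> \<Longrightarrow> U \<subseteq> topspace X"
    using sub by blast
  have "\<exists>A. (\<forall>n. A n \<in> (`) g ` \<A> n) \<and> iter_star k (\<Union>n. A n) ((`) g ` \<U>) = topspace X"
    using assms(2)[unfolded selectively_star_ccc_def, rule_format,
        of "(`) g ` \<U>" "\<lambda>n. (`) g ` \<A> n"] *
    by (simp add: open_cover_homeomorphic_image[OF g]
        maximal_disjoint_open_family_homeomorphic_image[OF g])
  then obtain A where A: "\<And>n. A n \<in> (`) g ` \<A> n"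
    "iter_star k (\<Union>n. A n) ((`) g ` \<U>) = topspace X"
    by blast
  have im: "(`) f ` (`) g ` \<U> = \<U>"
    unfolding image_image[where f = "(`) f"] using fgid sub by simp
  have "iter_star k (f ` (\<Union>n. A n)) ((`) f ` (`) g ` \<U>) = f ` topspace X"
  proof (subst iter_star_image[THEN conjunct2])
    show "inj_on f (topspace X)"
      using f by (auto simp: homeomorphic_eq_everything_map)
    show "(\<Union>n. A n) \<subseteq> topspace X"
      using A(1) subA gsub by blast
  qed (use gsub' A(2) in auto)
  then have "iter_star k (\<Union>n. f ` A n) \<U> = topspace Y"
    using f im by (simp add: homeomorphic_imp_surjective_map image_UN)
  moreover have "f ` A n \<in> \<A> n" for n
    using A(1)[of n] fgid subA by auto
  ultimately show "\<exists>A. (\<forall>n. A n \<in> \<A> n) \<and> iter_star k (\<Union>n. A n) \<U> = topspace Y"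
    by (intro exI[of _ "\<lambda>n. f ` A n"]) auto
qed

lemma DCCC_homeomorphic_space:
  assumes "X homeomorphic_space Y" "DCCC X"
  shows "DCCC Y"
  unfolding DCCC_def
proof (rule notI, elim exE conjE)
  fix \<F> assume \<F>: "uncountable \<F>" "\<forall>A\<in>\<F>. openin Y A \<and> A \<noteq> {}" "discrete_family Y \<F>"
  obtain f g where fg: "homeomorphic_maps X Y f g"
    using assms(1) by (auto simp: homeomorphic_space_def)
  then have f: "homeomorphic_map X Y f" and g: "homeomorphic_map Y X g"
    by (auto simp: homeomorphic_maps_map)
  have sub: "A \<subseteq> topspace Y" if "A \<in> \<F>" for A
    using \<F>(2) openin_subset that by blast
  have inj: "inj_on g (topspace Y)"
    using g by (auto simp: homeomorphic_eq_everything_map)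
  \<comment> \<open>Different members keep different images, so uncountability passes to
    \<open>X\<close>.\<close>
  then have "inj_on ((`) g) \<F>"
    by (metis (full_types) sub inj_onI inj_on_image_eq_iff)
  then have "uncountable ((`) g ` \<F>)"
    using \<F>(1) countable_image_inj_on by blast
  moreover have "\<forall>A\<in>(`) g ` \<F>. openin X A \<and> A \<noteq> {}"
    using \<F>(2) openin_homeomorphic_image[OF g] by auto
  moreover have "discrete_family X ((`) g ` \<F>)"
    unfolding discrete_family_def
  proof
    fix x assume x: "x \<in> topspace X"
    then have "f x \<in> topspace Y"
      using f homeomorphic_imp_surjective_map by blast
    then obtain V where V: "openin Y V" "f x \<in> V"
      "\<And>A B. A \<in> \<F> \<Longrightarrow> B \<in> \<F> \<Longrightarrow> V \<inter> A \<noteq> {} \<Longrightarrow> V \<inter> B \<noteq> {} \<Longrightarrow> A = B"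
      using \<F>(3) unfolding discrete_family_def by meson
    have meet: "V \<inter> A \<noteq> {}" if "A \<in> \<F>" "g ` V \<inter> g ` A \<noteq> {}" for A
      using that inj_on_image_Int[OF inj openin_subset[OF V(1)] sub[OF that(1)]] by auto
    have "x \<in> g ` V"
      using fg V(2) x by (force simp: homeomorphic_maps_def)
    moreover have "A = B" if AB: "A \<in> (`) g ` \<F>" "B \<in> (`) g ` \<F>" 
      "g ` V \<inter> A \<noteq> {}" "g ` V \<inter> B \<noteq> {}" for A B
    proof -
      obtain A' B' where "A' \<in> \<F>" "B' \<in> \<F>" "A = g ` A'" "B = g ` B'"
        using AB by blast
      moreover from this have "V \<inter> A' \<noteq> {}" "V \<inter> B' \<noteq> {}"
        using meet AB by auto
      ultimately show ?thesis using V(3) by blast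
    qed
    ultimately show "\<exists>V. openin X V \<and> x \<in> V \<and>
        (\<forall>A\<in>(`) g ` \<F>. \<forall>B\<in>(`) g ` \<F>. V \<inter> A \<noteq> {} \<and> V \<inter> B \<noteq> {} \<longrightarrow> A = B)"
      using openin_homeomorphic_image[OF g V(1)] by (intro exI[of _ "g ` V"]) blast
  qed
  ultimately show False
    using assms(2) unfolding DCCC_def by blast
qed

lemma first_countable_homeomorphic_space:
  assumes "X homeomorphic_space Y" "first_countable X"
  shows "first_countable Y"
  unfolding first_countable_def
proof
  fix y assume y: "y \<in> topspace Y"
  obtain f g where fg: "homeomorphic_maps X Y f g"
    using assms(1) by (auto simp: homeomorphic_space_def)
  then have f: "homeomorphic_map X Y f" and g: "homeomorphic_map Y X g"
    by (auto simp: homeomorphic_maps_map)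
  have gy: "g y \<in> topspace X"
    using y g homeomorphic_imp_surjective_map by blast
  obtain \<B> where \<B>: "countable \<B>" "\<forall>V\<in>\<B>. openin X V"
    "\<forall>U. openin X U \<and> g y \<in> U \<longrightarrow> (\<exists>V\<in>\<B>. g y \<in> V \<and> V \<subseteq> U)"
    using bspec[OF assms(2)[unfolded first_countable_def] gy]
    by (elim exE conjE) (rule that)
  have fgy: "f (g y) = y"
    using fg y by (simp add: homeomorphic_maps_def)
  have "\<exists>V\<in>(`) f ` \<B>. y \<in> V \<and> V \<subseteq> U" if U: "openin Y U" "y \<in> U" for U
  proof -
    have "openin X (g ` U)" "g y \<in> g ` U"
      using U openin_homeomorphic_image[OF g] by auto
    then obtain V where V: "V \<in> \<B>" "g y \<in> V" "V \<subseteq> g ` U"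
      using \<B>(3) by blast
    have "f ` g ` U = U"
      using fg openin_subset[OF U(1)] by (force simp: homeomorphic_maps_def image_image)
    then have "f ` V \<subseteq> U"
      using V(3) by blast
    moreover have "y \<in> f ` V"
      using V(2) fgy by (rule_tac image_eqI) auto
    ultimately show ?thesis using V(1) by blast
  qed
  moreover have "\<forall>V\<in>(`) f ` \<B>. openin Y V"
    using \<B>(2) openin_homeomorphic_image[OF f] by blast
  ultimately show "\<exists>\<B>. countable \<B> \<and> (\<forall>V\<in>\<B>. openin Y V) \<and>
      (\<forall>U. openin Y U \<and> y \<in> U \<longrightarrow> (\<exists>V\<in>\<B>. y \<in> V \<and> V \<subseteq> U))"
    using \<B>(1) by (intro exI[of _ "(`) f ` \<B>"]) auto
qed

text \<open>An injection of the points is enough: its image gets the topology pulled back along the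
  inverse map.\<close>

lemma homeomorphic_copy:
  fixes f :: "'a \<Rightarrow> 'b"
  assumes "inj_on f (topspace X)"
  shows "\<exists>Y :: 'b topology. X homeomorphic_space Y"
proof -
  define g where "g = the_inv_into (topspace X) f"
  define Y where "Y = pullback_topology (f ` topspace X) g X"
  have gf: "g (f x) = x" if "x \<in> topspace X" for x
    using assms that by (simp add: g_def the_inv_into_f_f)
  have top: "topspace Y = f ` topspace X"
    using gf by (auto simp: Y_def topspace_pullback_topology)
  have "continuous_map X Y f"
    unfolding continuous_map_def
  proof (intro conjI allI impI)
    show "f \<in> topspace X \<rightarrow> topspace Y" using top by auto
    fix V assume "openin Y V"
    then obtain U where U: "openin X U" "V = g -` U \<inter> f ` topspace X"
      by (auto simp: Y_def openin_pullback_topology)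
    then have "{x \<in> topspace X. f x \<in> V} = U"
      using gf openin_subset[OF U(1)] by (auto, metis)
    then show "openin X {x \<in> topspace X. f x \<in> V}" using U by simp
  qed
  moreover have "continuous_map Y X g"
    unfolding continuous_map_def
  proof (intro conjI allI impI)
    show "g \<in> topspace Y \<rightarrow> topspace X" using top gf by auto
    fix U assume "openin X U"
    moreover have "{y \<in> topspace Y. g y \<in> U} = g -` U \<inter> f ` topspace X"
      using top by auto
    ultimately show "openin Y {y \<in> topspace Y. g y \<in> U}"
      by (auto simp: Y_def openin_pullback_topology)
  qed
  ultimately have "homeomorphic_maps X Y f g"
    using gf top by (auto simp: homeomorphic_maps_def)
  then show ?thesis
    using homeomorphic_space_def by blast
qed

section \<open>Linked classes and unselectable families\<close>

text \<open>One representative is kept for each index \<open>j\<close> whose class is occupied;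
  every \<open>U\<close> shares a class with a representative and therefore meets it. Both
  star-Lindelof proofs rest on this.\<close>

lemma countable_subfamily_meeting_all:
  assumes "countable J"
    and P: "\<And>U. U \<in> \<U> \<Longrightarrow> \<exists>j\<in>J. P j U"
    and linked: "\<And>j U V. j \<in> J \<Longrightarrow> P j U \<Longrightarrow> P j V \<Longrightarrow> U \<inter> V \<noteq> {}"
  shows "\<exists>\<V>. countable \<V> \<and> \<V> \<subseteq> \<U> \<and> (\<forall>U\<in>\<U>. U \<inter> \<Union>\<V> \<noteq> {})"
proof -
  define K where "K = {j \<in> J. \<exists>U\<in>\<U>. P j U}"
  have "\<forall>j\<in>K. \<exists>U. U \<in> \<U> \<and> P j U"
    by (auto simp: K_def)
  then obtain c where c: "\<And>j. j \<in> K \<Longrightarrow> c j \<in> \<U> \<and> P j (c j)"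
    by metis
  have "U \<inter> \<Union>(c ` K) \<noteq> {}" if U: "U \<in> \<U>" for U
  proof -
    obtain j where "j \<in> J" "P j U" using P[OF U] by blast
    with U have "j \<in> K" by (auto simp: K_def)
    with c linked \<open>j \<in> J\<close> \<open>P j U\<close> have "U \<inter> c j \<noteq> {}" by blast
    with \<open>j \<in> K\<close> show ?thesis by blast
  qed
  moreover have "countable (c ` K)"
    using assms(1) by (simp add: K_def)
  moreover have "c ` K \<subseteq> \<U>"
    using c by blast
  ultimately show ?thesis by blast
qed

text \<open>A finite set is null, so outer regularity of Lebesgue measure bounds the measure of the
  whole open superset, not just of the excess.\<close>

lemma small_open_superset:
  fixes F :: "real set"
  assumes "finite F" "0 < e"
  shows "\<exists>U. open U \<and> F \<subseteq> U \<and> emeasure lborel U \<le> ennreal e"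
proof -
  have "F \<in> sets lebesgue" "emeasure lebesgue F = 0"
    using assms(1) by (auto simp: emeasure_completion finite_imp_closed emeasure_lborel_countable countable_finite)
  then obtain T where T: "open T" "F \<subseteq> T" "T - F \<in> lmeasurable" "emeasure lebesgue (T - F) < ennreal e"
    using sets_lebesgue_outer_open[OF _ assms(2)] by metis
  have "emeasure lborel T = emeasure lebesgue ((T - F) \<union> F)"
    using T by (simp add: Un_absorb2)
  also have "\<dots> \<le> emeasure lebesgue (T - F) + emeasure lebesgue F"
    using T(3) \<open>F \<in> sets lebesgue\<close> by (intro emeasure_subadditive) auto
  finally have "emeasure lborel T \<le> ennreal e"
    using T(4) \<open>emeasure lebesgue F = 0\<close> by simp
  with T show ?thesis by blast
qed

text \<open>The bounds add up to exactly 1, while the line has infinite measure.\<close>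

lemma not_covered_by_small_sets:
  assumes "\<And>n. U n \<in> sets borel" "\<And>n. emeasure lborel (U n) \<le> ennreal ((1/2) ^ Suc n)"
  shows "\<exists>x::real. \<forall>n. x \<notin> U n"
proof (rule ccontr)
  assume "\<not> ?thesis"
  then have "(\<Union>n. U n) = UNIV" by auto
  have "emeasure lborel (\<Union>n. U n) \<le> (\<Sum>n. emeasure lborel (U n))"
    using assms(1) by (intro emeasure_subadditive_countably) auto
  also have "\<dots> \<le> (\<Sum>n. ennreal ((1/2) ^ Suc n))"
    by (intro suminf_le assms(2)) auto
  also have "\<dots> = ennreal 1"
    using power_half_series by (subst suminf_ennreal2) (auto simp: sums_iff)
  finally show False
    unfolding \<open>(\<Union>n. U n) = UNIV\<close> by (simp add: emeasure_lborel_UNIV top_unique)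
qed

text \<open>The sets of the \<open>n\<close>-th family have supports inside open sets of measure at most \<open>2\<^sup>-\<^sup>n\<^sup>-\<^sup>1\<close>,
  so that any selection leaves most of the line untouched.\<close>

lemma exists_unselectable_families:
  fixes supp :: "'p \<Rightarrow> real set"
  assumes small: "\<And>V e. openin X V \<Longrightarrow> V \<noteq> {} \<Longrightarrow> 0 < e \<Longrightarrow>
    \<exists>W\<subseteq>V. openin X W \<and> W \<noteq> {} \<and>
      (\<exists>U. open U \<and> emeasure lborel U \<le> ennreal e \<and> (\<forall>p\<in>W. supp p \<subseteq> U))"
  shows "\<exists>\<A>. (\<forall>n::nat. maximal_disjoint_open_family X (\<A> n)) \<and>
    (\<forall>A. (\<forall>n. A n \<in> \<A> n) \<longrightarrow> (\<exists>x. \<forall>p\<in>\<Union>n. A n. x \<notin> supp p))"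
proof -
  define P where "P n W \<longleftrightarrow> (\<exists>U. open U \<and> emeasure lborel U \<le> ennreal ((1/2) ^ Suc n) \<and> (\<forall>p\<in>W. supp p \<subseteq> U))"
    for n :: nat and W
  have "\<exists>\<A>. maximal_disjoint_open_family X \<A> \<and> (\<forall>A\<in>\<A>. P n A)" for n
    \<comment> \<open>Smallness can be demanded of every member because \<open>small\<close> finds a
      small nonempty open set inside any nonempty open set.\<close>
    by (rule exists_maximal_disjoint_open_family) (use small in \<open>simp add: P_def\<close>)
  then obtain \<A> where \<A>: "\<And>n. maximal_disjoint_open_family X (\<A> n)" "\<And>n A. A \<in> \<A> n \<Longrightarrow> P n A"
    by metis
  have "\<exists>x. \<forall>p\<in>\<Union>n. A n. x \<notin> supp p" if "\<forall>n. A n \<in> \<A> n" for A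
  proof -
    have "\<forall>n. P n (A n)" using that \<A>(2) by blast
    then obtain U where U: "\<And>n. open (U n)" "\<And>n. emeasure lborel (U n) \<le> ennreal ((1/2) ^ Suc n)"
      "\<And>n p. p \<in> A n \<Longrightarrow> supp p \<subseteq> U n"
      unfolding P_def by metis
    then obtain x where "\<forall>n. x \<notin> U n"
      using not_covered_by_small_sets[of U] by auto
    with U(3) show ?thesis by blast
  qed
  with \<A>(1) show ?thesis by blast
qed

section \<open>The Pixley--Roy space\<close>

text \<open>The interval [F,U] of the Pixley-Roy topology. It is empty unless
  \<open>F \<subseteq> U\<close>, and for \<open>F = {}\<close> it contains the empty set, which is
  not a point of the space; hence the assumption \<open>F \<noteq> {}\<close> for openness.\<close>

definition pr_basic :: "'a set \<Rightarrow> 'a set \<Rightarrow> 'a set set" where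
  "pr_basic F U = {G. finite G \<and> F \<subseteq> G \<and> G \<subseteq> U}"

lemma pr_basic_mono: "U \<subseteq> V \<Longrightarrow> pr_basic F U \<subseteq> pr_basic F V"
  by (auto simp: pr_basic_def)

definition pixley_roy :: "'a::topological_space set topology" where
  "pixley_roy = topology (\<lambda>\<W>. \<forall>F\<in>\<W>. finite F \<and> F \<noteq> {} \<and>
     (\<exists>U. open U \<and> F \<subseteq> U \<and> pr_basic F U \<subseteq> \<W>))"

lemma openin_pixley_roy:
  "openin pixley_roy \<W> \<longleftrightarrow> (\<forall>F\<in>\<W>. finite F \<and> F \<noteq> {} \<and>
     (\<exists>U. open U \<and> F \<subseteq> U \<and> pr_basic F U \<subseteq> \<W>))"
proof -
  define L where "L \<W> \<longleftrightarrow> (\<forall>F\<in>\<W>. finite F \<and> F \<noteq> {} \<and>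
     (\<exists>U. open U \<and> F \<subseteq> U \<and> pr_basic F U \<subseteq> \<W>))" for \<W> :: "'a set set"
  have "L (S \<inter> T)" if S: "L S" and T: "L T" for S T
    unfolding L_def
  proof
    fix F assume "F \<in> S \<inter> T"
    then have F: "F \<in> S" "F \<in> T" by auto
    obtain U where U: "finite F" "F \<noteq> {}" "open U" "F \<subseteq> U" "pr_basic F U \<subseteq> S"
      using S F(1) unfolding L_def by meson
    obtain V where V: "open V" "F \<subseteq> V" "pr_basic F V \<subseteq> T"
      using T F(2) unfolding L_def by meson
    have "pr_basic F (U \<inter> V) \<subseteq> S \<inter> T"
      using U(5) V(3) by (auto simp: pr_basic_def)
    with U V show "finite F \<and> F \<noteq> {} \<and> (\<exists>U. open U \<and> F \<subseteq> U \<and> pr_basic F U \<subseteq> S \<inter> T)"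
      by (meson Int_greatest open_Int)
  qed
  moreover have "L (\<Union>\<K>)" if "\<forall>K\<in>\<K>. L K" for \<K>
    using that unfolding L_def by (meson Union_iff Union_upper subset_trans)
  ultimately have "istopology L"
    by (simp add: istopology_def)
  moreover have "pixley_roy = topology L"
    unfolding pixley_roy_def L_def ..
  ultimately have "openin pixley_roy \<W> \<longleftrightarrow> L \<W>"
    using topology_inverse'[of L] by simp
  then show ?thesis
    by (simp add: L_def)
qed

lemma openin_pixley_royE:
  assumes "openin pixley_roy \<W>" "F \<in> \<W>"
  obtains U where "finite F" "F \<noteq> {}" "open U" "F \<subseteq> U" "pr_basic F U \<subseteq> \<W>"
  using assms unfolding openin_pixley_roy by meson

text \<open>The same \<open>U\<close> serves at every point \<open>G\<close> of the interval,
  because raising the lower bound from \<open>F\<close> to \<open>G\<close> only shrinks it.\<close>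

lemma openin_pr_basic:
  assumes "F \<noteq> {}" "open U"
  shows "openin pixley_roy (pr_basic F U)"
  unfolding openin_pixley_roy
proof
  fix G assume "G \<in> pr_basic F U"
  with assms show "finite G \<and> G \<noteq> {} \<and> (\<exists>U'. open U' \<and> G \<subseteq> U' \<and> pr_basic G U' \<subseteq> pr_basic F U)"
    by (auto simp: pr_basic_def intro!: exI[of _ U])
qed

lemma topspace_pixley_roy: "topspace pixley_roy = {F. finite F \<and> F \<noteq> {}}"
proof (intro equalityI subsetI)
  fix F :: "'a set" assume "F \<in> {F. finite F \<and> F \<noteq> {}}"
  then have "F \<in> pr_basic F UNIV" "openin pixley_roy (pr_basic F UNIV)"
    using openin_pr_basic[of F UNIV] by (auto simp: pr_basic_def)
  then show "F \<in> topspace pixley_roy"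
    using openin_subset by blast
next
  fix F :: "'a set" assume "F \<in> topspace pixley_roy"
  then show "F \<in> {F. finite F \<and> F \<noteq> {}}"
    using openin_pixley_royE[OF openin_topspace] by blast
qed

section \<open>Separation and countability in the Pixley-Roy space\<close>

lemma pr_basic_separate:
  "x \<in> F \<Longrightarrow> pr_basic F UNIV \<inter> pr_basic G (- {x}) = {}"
  by (auto simp: pr_basic_def)

text \<open>Distinct finite sets differ in some \<open>x\<close>. The finite sets containing
  \<open>x\<close> are kept apart from those avoiding it, and in a T1 space the complement of
  \<open>x\<close> is an open upper bound.\<close>

lemma Hausdorff_pixley_roy: "Hausdorff_space (pixley_roy :: 'a::t1_space set topology)"
proof -
  have sep: "\<exists>U V. openin pixley_roy U \<and> openin pixley_roy V \<and> F \<in> U \<and> G \<in> V \<and> disjnt U V"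
    if "finite F" "F \<noteq> {}" "finite G" "G \<noteq> {}" "x \<in> F" "x \<notin> G" for F G :: "'a set" and x
  proof (intro exI conjI)
    show "openin pixley_roy (pr_basic F UNIV)" "openin pixley_roy (pr_basic G (- {x}))"
      using that by (auto intro!: openin_pr_basic)
    show "disjnt (pr_basic F UNIV) (pr_basic G (- {x}))"
      using that(5) by (simp add: disjnt_def pr_basic_separate)
  qed (use that in \<open>auto simp: pr_basic_def\<close>)
  show ?thesis
    unfolding Hausdorff_space_def topspace_pixley_roy
  proof (intro allI impI)
    fix F G :: "'a set"
    assume *: "F \<in> {F. finite F \<and> F \<noteq> {}} \<and> G \<in> {F. finite F \<and> F \<noteq> {}} \<and> F \<noteq> G"
    then consider x where "x \<in> F" "x \<notin> G" | x where "x \<in> G" "x \<notin> F" by blast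
    then show "\<exists>U V. openin pixley_roy U \<and> openin pixley_roy V \<and> F \<in> U \<and> G \<in> V \<and> disjnt U V"
    proof cases
      case 1 then show ?thesis using sep * by blast
    next
      case 2
      then obtain U V where "openin pixley_roy U" "openin pixley_roy V" "G \<in> U" "F \<in> V" "disjnt U V"
        using sep[of G F x] * by auto
      then show ?thesis
        by (intro exI[of _ V] exI[of _ U]) (simp add: disjnt_sym)
    qed
  qed
qed

text \<open>Finite unions of members of a countable base suffice, as each point of \<open>F\<close>
  needs just one basic set inside \<open>U\<close>. These sets give both the countable local bases
  and the countably many linked classes.\<close>

lemma countable_finite_interpolation:
  obtains \<C> :: "'a::second_countable_topology set set"
  where "countable \<C>" "\<And>W. W \<in> \<C> \<Longrightarrow> open W"
    "\<And>F U. finite F \<Longrightarrow> open U \<Longrightarrow> F \<subseteq> U \<Longrightarrow> \<exists>W\<in>\<C>. F \<subseteq> W \<and> W \<subseteq> U"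
proof -
  obtain B :: "'a set set" where B: "countable B" "topological_basis B"
    using ex_countable_basis by blast
  define \<C> where "\<C> = Union ` {\<F>. finite \<F> \<and> \<F> \<subseteq> B}"
  have "countable \<C>"
    unfolding \<C>_def using B(1) by (intro countable_image countable_Collect_finite_subset)
  moreover have "open W" if "W \<in> \<C>" for W
    using that topological_basis_open[OF B(2)] by (auto simp: \<C>_def)
  moreover have "\<exists>W\<in>\<C>. F \<subseteq> W \<and> W \<subseteq> U" if "finite F" "open U" "F \<subseteq> U" for F U
  proof -
    have "\<exists>b. b \<in> B \<and> x \<in> b \<and> b \<subseteq> U" if "x \<in> F" for x
      using topological_basisE[OF B(2) \<open>open U\<close>] \<open>F \<subseteq> U\<close> that by (metis subsetD)
    then obtain b where b: "\<And>x. x \<in> F \<Longrightarrow> b x \<in> B \<and> x \<in> b x \<and> b x \<subseteq> U"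
      by metis
    then have "b ` F \<in> {\<F>. finite \<F> \<and> \<F> \<subseteq> B}" "F \<subseteq> \<Union>(b ` F)" "\<Union>(b ` F) \<subseteq> U"
      using \<open>finite F\<close> by auto
    then show ?thesis
      unfolding \<C>_def by blast
  qed
  ultimately show ?thesis
    by (rule that)
qed

lemma pr_basic_local_base:
  fixes F :: "'a::second_countable_topology set"
  obtains \<B> where "countable \<B>" "\<And>V. V \<in> \<B> \<Longrightarrow> openin pixley_roy V \<and> F \<in> V"
    "\<And>U. openin pixley_roy U \<Longrightarrow> F \<in> U \<Longrightarrow> \<exists>V\<in>\<B>. V \<subseteq> U"
proof (cases "finite F \<and> F \<noteq> {}")
  case True
  obtain \<C> :: "'a set set" where \<C>: "countable \<C>" "\<And>W. W \<in> \<C> \<Longrightarrow> open W"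
    "\<And>F U. finite F \<Longrightarrow> open U \<Longrightarrow> F \<subseteq> U \<Longrightarrow> \<exists>W\<in>\<C>. F \<subseteq> W \<and> W \<subseteq> U"
    by (rule countable_finite_interpolation) (rule that)
  show ?thesis
  proof (rule that[of "pr_basic F ` {W \<in> \<C>. F \<subseteq> W}"])
    show "countable (pr_basic F ` {W \<in> \<C>. F \<subseteq> W})"
      using \<C>(1) by simp
    show "openin pixley_roy V \<and> F \<in> V" if "V \<in> pr_basic F ` {W \<in> \<C>. F \<subseteq> W}" for V
      using that True \<C>(2) openin_pr_basic by (auto simp: pr_basic_def)
    fix U assume "openin pixley_roy U" "F \<in> U"
    then obtain U' where U': "open U'" "F \<subseteq> U'" "pr_basic F U' \<subseteq> U"
      by (rule openin_pixley_royE)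
    then obtain W where "W \<in> \<C>" "F \<subseteq> W" "W \<subseteq> U'"
      using \<C>(3) True by meson
    then have "pr_basic F W \<subseteq> U"
      using U'(3) by (auto simp: pr_basic_def)
    with \<open>W \<in> \<C>\<close> \<open>F \<subseteq> W\<close> show "\<exists>V\<in>pr_basic F ` {W \<in> \<C>. F \<subseteq> W}. V \<subseteq> U"
      by blast
  qed
next
  \<comment> \<open>Such an \<open>F\<close> is not a point and lies in no open set, so the empty
    family is a local base vacuously.\<close>
  case False
  then show ?thesis
    by (intro that[of "{}"]) (auto simp: openin_pixley_roy)
qed

lemma first_countable_pixley_roy:
  "first_countable (pixley_roy :: 'a::second_countable_topology set topology)"
  unfolding first_countable_def
proof
  fix F :: "'a set" assume "F \<in> topspace pixley_roy"
  obtain \<B> where "countable \<B>" "\<And>V. V \<in> \<B> \<Longrightarrow> openin pixley_roy V \<and> F \<in> V"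
    "\<And>U. openin pixley_roy U \<Longrightarrow> F \<in> U \<Longrightarrow> \<exists>V\<in>\<B>. V \<subseteq> U"
    by (rule pr_basic_local_base[of F]) (rule that)
  then show "\<exists>\<B>. countable \<B> \<and> (\<forall>V\<in>\<B>. openin pixley_roy V) \<and>
      (\<forall>U. openin pixley_roy U \<and> F \<in> U \<longrightarrow> (\<exists>V\<in>\<B>. F \<in> V \<and> V \<subseteq> U))"
    by (intro exI[of _ \<B>] conjI) (simp, simp, meson)
qed

lemma pr_basic_linked:
  assumes "finite F" "F \<subseteq> W" "finite G" "G \<subseteq> W"
  shows "F \<union> G \<in> pr_basic F W \<inter> pr_basic G W"
  using assms by (auto simp: pr_basic_def)

section \<open>Star properties of the Pixley-Roy space\<close>

lemma star_Lindelof_pixley_roy: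
  "star_Lindelof 1 (pixley_roy :: 'a::second_countable_topology set topology)"
  unfolding star_Lindelof_def
proof (intro allI impI)
  fix \<U> :: "'a set set set" assume \<U>: "open_cover pixley_roy \<U>"
  obtain \<C> :: "'a set set" where \<C>: "countable \<C>" "\<And>W. W \<in> \<C> \<Longrightarrow> open W"
    "\<And>F U. finite F \<Longrightarrow> open U \<Longrightarrow> F \<subseteq> U \<Longrightarrow> \<exists>W\<in>\<C>. F \<subseteq> W \<and> W \<subseteq> U"
    by (rule countable_finite_interpolation) (rule that)
  \<comment> \<open>Class \<open>W\<close> collects the sets containing an interval with upper bound
    \<open>W\<close>; two such intervals share the union of their lower bounds.\<close>
  define P where "P W U \<longleftrightarrow> (\<exists>F. finite F \<and> F \<subseteq> W \<and> pr_basic F W \<subseteq> U)" for W and U :: "'a set set"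
  \<comment> \<open>The empty set may belong to the cover but meets nothing, so it is set
    aside.\<close>
  have "\<exists>\<V>. countable \<V> \<and> \<V> \<subseteq> \<U> - {{}} \<and> (\<forall>U\<in>\<U> - {{}}. U \<inter> \<Union>\<V> \<noteq> {})"
  proof (rule countable_subfamily_meeting_all[OF \<C>(1), where P = P])
    fix U assume U: "U \<in> \<U> - {{}}"
    then obtain F where "F \<in> U" by blast
    moreover have "openin pixley_roy U"
      using U \<U> by (simp add: open_cover_def)
    ultimately obtain U' where U': "finite F" "open U'" "F \<subseteq> U'" "pr_basic F U' \<subseteq> U"
      by (rule_tac openin_pixley_royE)
    then obtain W where W: "W \<in> \<C>" "F \<subseteq> W" "W \<subseteq> U'"
      using \<C>(3) by meson
    have "pr_basic F W \<subseteq> U"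
      using pr_basic_mono[OF W(3)] U'(4) by (rule subset_trans)
    with U'(1) W(2) have "P W U"
      unfolding P_def by (intro exI[of _ F] conjI)
    with W(1) show "\<exists>W\<in>\<C>. P W U" by blast
  next
    fix W U V assume "P W U" "P W V"
    then obtain F G where "finite F" "F \<subseteq> W" "pr_basic F W \<subseteq> U" "finite G" "G \<subseteq> W" "pr_basic G W \<subseteq> V"
      unfolding P_def by meson
    then show "U \<inter> V \<noteq> {}"
      using pr_basic_linked[of F W G] by auto
  qed
  then obtain \<V> where \<V>: "countable \<V>" "\<V> \<subseteq> \<U> - {{}}"
    "\<forall>U\<in>\<U> - {{}}. U \<inter> \<Union>\<V> \<noteq> {}"
    by (elim exE conjE) (rule that)
  have "star (\<Union>\<V>) \<U> = \<Union>\<U>"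
  proof (intro equalityI subsetI)
    fix F assume "F \<in> \<Union>\<U>"
    then obtain U where U: "U \<in> \<U>" "F \<in> U" by blast
    then have "U \<inter> \<Union>\<V> \<noteq> {}"
      using \<V>(3) by auto
    with U show "F \<in> star (\<Union>\<V>) \<U>"
      unfolding star_def by blast
  qed (auto simp: star_def)
  moreover have "\<V> \<subseteq> \<U>"
    using \<V>(2) by auto
  ultimately show "\<exists>\<V>. countable \<V> \<and> \<V> \<subseteq> \<U> \<and> iter_star 1 (\<Union>\<V>) \<U> = topspace pixley_roy"
    using \<V>(1) \<U> by (intro exI[of _ \<V>]) (simp add: open_cover_def)
qed

lemma not_selectively_star_ccc_pixley_roy:
  "\<not> selectively_star_ccc 1 (pixley_roy :: real set topology)"
proof
  assume sel: "selectively_star_ccc 1 (pixley_roy :: real set topology)"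
  have "\<exists>\<A>. (\<forall>n::nat. maximal_disjoint_open_family (pixley_roy :: real set topology) (\<A> n)) \<and>
    (\<forall>A. (\<forall>n. A n \<in> \<A> n) \<longrightarrow> (\<exists>x. \<forall>F\<in>\<Union>n. A n. x \<notin> F))"
  proof (rule exists_unselectable_families)
    fix V :: "real set set" and e :: real
    assume "openin pixley_roy V" "V \<noteq> {}" "0 < e"
    then obtain F U where F: "finite F" "F \<noteq> {}" "open U" "F \<subseteq> U" "pr_basic F U \<subseteq> V"
      by (metis all_not_in_conv openin_pixley_roy)
    obtain T where T: "open T" "F \<subseteq> T" "emeasure lborel T \<le> ennreal e"
      using small_open_superset F(1) \<open>0 < e\<close> by blast
    show "\<exists>W\<subseteq>V. openin pixley_roy W \<and> W \<noteq> {} \<and>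
      (\<exists>U. open U \<and> emeasure lborel U \<le> ennreal e \<and> (\<forall>F\<in>W. F \<subseteq> U))"
    \<comment> \<open>Cutting the upper bound down to \<open>T\<close> forces every finite set of
      the interval into a set of measure at most \<open>e\<close>.\<close>
    proof (intro exI[of _ "pr_basic F (U \<inter> T)"] conjI)
      show "openin pixley_roy (pr_basic F (U \<inter> T))"
        using F T by (intro openin_pr_basic) auto
      show "pr_basic F (U \<inter> T) \<noteq> {}"
        using F T by (auto simp: pr_basic_def)
    qed (use F T in \<open>auto simp: pr_basic_def\<close>)
  qed
  then obtain \<A> where \<A>: "\<And>n::nat. maximal_disjoint_open_family pixley_roy (\<A> n)"
    "\<And>A. (\<And>n. A n \<in> \<A> n) \<Longrightarrow> \<exists>x::real. \<forall>F\<in>\<Union>n. A n. x \<notin> F"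
    by blast
  define \<U> where "\<U> = (\<lambda>x::real. pr_basic {x} UNIV) ` UNIV"
  have "open_cover pixley_roy \<U>"
    unfolding open_cover_def
  proof
    show "\<forall>U\<in>\<U>. openin pixley_roy U"
      by (auto simp: \<U>_def intro!: openin_pr_basic)
    show "\<Union>\<U> = topspace pixley_roy"
      by (auto simp: \<U>_def topspace_pixley_roy pr_basic_def)
  qed
  then obtain A where A: "\<And>n. A n \<in> \<A> n" "star (\<Union>n. A n) \<U> = topspace pixley_roy"
    using sel[unfolded selectively_star_ccc_def, rule_format, of \<U> \<A>] \<A>(1) by auto
  obtain x where x: "\<forall>F\<in>\<Union>n. A n. x \<notin> F"
    using \<A>(2)[OF A(1)] by blast
  have "{x} \<in> star (\<Union>n. A n) \<U>"
    unfolding A(2) by (simp add: topspace_pixley_roy)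
  then show False
    using x by (auto simp: star_def \<U>_def pr_basic_def)
qed

section \<open>The space without the DCCC\<close>

text \<open>Codes of the integer parts of \<open>k\<close> times the coordinates: approximations of
  \<open>p\<close> at scale 1/k. Recording the level \<open>k\<close> makes each sequence injective
  and lets sequences of two points agree only at equal levels.\<close>

definition ladder :: "real \<times> real \<Rightarrow> nat \<Rightarrow> nat" where
  "ladder p k = to_nat (k, \<lfloor>real k * fst p\<rfloor>, \<lfloor>real k * snd p\<rfloor>)"

lemma ladder_eq_imp_level_eq: "ladder p k = ladder q l \<Longrightarrow> k = l"
  by (simp add: ladder_def)

text \<open>Equal integer parts force a distance below 1, but k times the distance of
  \<open>x\<close> and \<open>y\<close> exceeds 1 from some \<open>k\<close> on.\<close>

lemma floor_multiples_eventually_differ: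
  fixes x y :: real
  assumes "x \<noteq> y"
  shows "\<exists>m. \<forall>k\<ge>m. \<lfloor>real k * x\<rfloor> \<noteq> \<lfloor>real k * y\<rfloor>"
proof -
  obtain m :: nat where m: "1 < real m * \<bar>x - y\<bar>"
    using reals_Archimedean3[of "\<bar>x - y\<bar>"] assms by auto
  have "\<lfloor>real k * x\<rfloor> \<noteq> \<lfloor>real k * y\<rfloor>" if "k \<ge> m" for k
  proof
    assume "\<lfloor>real k * x\<rfloor> = \<lfloor>real k * y\<rfloor>"
    then have "\<bar>real k * x - real k * y\<bar> < 1"
      by linarith
    also have "\<bar>real k * x - real k * y\<bar> = real k * \<bar>x - y\<bar>"
      by (simp flip: right_diff_distrib add: abs_mult)
    finally have "real k * \<bar>x - y\<bar> < 1" .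
    moreover have "real m * \<bar>x - y\<bar> \<le> real k * \<bar>x - y\<bar>"
      using that by (intro mult_right_mono) auto
    ultimately show False using m by linarith
  qed
  then show ?thesis by blast
qed

text \<open>Only equal levels can collide, and there any coordinate in which \<open>p\<close> and
  \<open>q\<close> differ separates the codes from some level on. This is the almost disjointness
  behind the Hausdorff property.\<close>

lemma ladder_eventually_differ:
  assumes "p \<noteq> q"
  shows "\<exists>m. \<forall>k\<ge>m. \<forall>l\<ge>m. ladder p k \<noteq> ladder q l"
proof -
  have "\<exists>m. \<forall>k\<ge>m. ladder p k \<noteq> ladder q k"
  proof (cases "fst p = fst q")
    case True
    with assms have "snd p \<noteq> snd q" by (simp add: prod_eq_iff)
    then show ?thesis
      using floor_multiples_eventually_differ[of "snd p" "snd q"] by (auto simp: ladder_def)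
  next
    case False
    then show ?thesis
      using floor_multiples_eventually_differ[of "fst p" "fst q"] by (auto simp: ladder_def)
  qed
  then show ?thesis
    using ladder_eq_imp_level_eq by metis
qed

section \<open>The topology of the fibred space\<close>

text \<open>\<open>Inl (F, i)\<close> is the point \<open>F\<close> of the \<open>i\<close>-th Pixley--Roy copy, \<open>Inr (x, r)\<close> the point \<open>r\<close> of
  the \<open>x\<close>-th line.\<close>

definition fibred_open :: "((real set \<times> nat) + (real \<times> real)) set \<Rightarrow> bool" where
  "fibred_open W \<longleftrightarrow>
     (\<forall>i. openin pixley_roy {F. Inl (F, i) \<in> W}) \<and>
     (\<forall>x r. Inr (x, r) \<in> W \<longrightarrow>
        (\<exists>e>0. \<forall>s\<in>\<rat>. \<bar>s - r\<bar> < e \<longrightarrow> Inr (x, s) \<in> W) \<and>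
        (r \<notin> \<rat> \<longrightarrow> (\<exists>m. \<forall>k\<ge>m. \<forall>F. finite F \<and> x \<in> F \<longrightarrow> Inl (F, ladder (x, r) k) \<in> W)))"

definition fibred_space :: "((real set \<times> nat) + (real \<times> real)) topology" where
  "fibred_space = topology fibred_open"

lemma fibred_openI:
  assumes "\<And>i. openin pixley_roy {F. Inl (F, i) \<in> W}"
    and "\<And>x r. Inr (x, r) \<in> W \<Longrightarrow> \<exists>e>0. \<forall>s\<in>\<rat>. \<bar>s - r\<bar> < e \<longrightarrow> Inr (x, s) \<in> W"
    and "\<And>x r. Inr (x, r) \<in> W \<Longrightarrow> r \<notin> \<rat> \<Longrightarrow>
           \<exists>m. \<forall>k\<ge>m. \<forall>F. finite F \<and> x \<in> F \<longrightarrow> Inl (F, ladder (x, r) k) \<in> W"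
  shows "fibred_open W"
  using assms unfolding fibred_open_def by simp

lemma fibred_openD:
  assumes "fibred_open W"
  shows "openin pixley_roy {F. Inl (F, i) \<in> W}"
    and "Inr (x, r) \<in> W \<Longrightarrow> \<exists>e>0. \<forall>s\<in>\<rat>. \<bar>s - r\<bar> < e \<longrightarrow> Inr (x, s) \<in> W"
    and "Inr (x, r) \<in> W \<Longrightarrow> r \<notin> \<rat> \<Longrightarrow>
           \<exists>m. \<forall>k\<ge>m. \<forall>F. finite F \<and> x \<in> F \<longrightarrow> Inl (F, ladder (x, r) k) \<in> W"
  using assms unfolding fibred_open_def by simp_all

lemma openin_fibred_space: "openin fibred_space = fibred_open"
proof -
  have "fibred_open (S \<inter> T)" if S: "fibred_open S" and T: "fibred_open T" for S T
  proof (rule fibred_openI)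
    fix i
    have "{F. Inl (F, i) \<in> S \<inter> T} = {F. Inl (F, i) \<in> S} \<inter> {F. Inl (F, i) \<in> T}"
      by auto
    then show "openin pixley_roy {F. Inl (F, i) \<in> S \<inter> T}"
      using fibred_openD(1)[OF S] fibred_openD(1)[OF T] by (simp add: openin_Int)
  next
    fix x r assume "Inr (x, r) \<in> S \<inter> T"
    then have "Inr (x, r) \<in> S" "Inr (x, r) \<in> T" by auto
    then obtain d e where "d > 0" "\<forall>s\<in>\<rat>. \<bar>s - r\<bar> < d \<longrightarrow> Inr (x, s) \<in> S"
      "e > 0" "\<forall>s\<in>\<rat>. \<bar>s - r\<bar> < e \<longrightarrow> Inr (x, s) \<in> T"
      using fibred_openD(2)[OF S] fibred_openD(2)[OF T] by meson
    then show "\<exists>e>0. \<forall>s\<in>\<rat>. \<bar>s - r\<bar> < e \<longrightarrow> Inr (x, s) \<in> S \<inter> T"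
      by (intro exI[of _ "min d e"]) auto
  next
    fix x r :: real assume "Inr (x, r) \<in> S \<inter> T" "r \<notin> \<rat>"
    then have "Inr (x, r) \<in> S" "Inr (x, r) \<in> T" "r \<notin> \<rat>" by auto
    then obtain m n where "\<forall>k\<ge>m. \<forall>F. finite F \<and> x \<in> F \<longrightarrow> Inl (F, ladder (x, r) k) \<in> S"
      "\<forall>k\<ge>n. \<forall>F. finite F \<and> x \<in> F \<longrightarrow> Inl (F, ladder (x, r) k) \<in> T"
      using fibred_openD(3)[OF S] fibred_openD(3)[OF T] by meson
    then show "\<exists>m. \<forall>k\<ge>m. \<forall>F. finite F \<and> x \<in> F \<longrightarrow> Inl (F, ladder (x, r) k) \<in> S \<inter> T"
      by (intro exI[of _ "max m n"]) auto
  qed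
  moreover have "fibred_open (\<Union>\<K>)" if K: "\<forall>K\<in>\<K>. fibred_open K" for \<K>
  proof (rule fibred_openI)
    fix i
    have "{F. Inl (F, i) \<in> \<Union>\<K>} = (\<Union>K\<in>\<K>. {F. Inl (F, i) \<in> K})"
      by auto
    then show "openin pixley_roy {F. Inl (F, i) \<in> \<Union>\<K>}"
      using fibred_openD(1) K by auto
  next
    fix x r assume "Inr (x, r) \<in> \<Union>\<K>"
    then obtain K where "K \<in> \<K>" "Inr (x, r) \<in> K" by blast
    then show "\<exists>e>0. \<forall>s\<in>\<rat>. \<bar>s - r\<bar> < e \<longrightarrow> Inr (x, s) \<in> \<Union>\<K>"
      using fibred_openD(2)[of K x r] K by (meson UnionI)
  next
    fix x r :: real assume "Inr (x, r) \<in> \<Union>\<K>" "r \<notin> \<rat>"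
    then obtain K where "K \<in> \<K>" "Inr (x, r) \<in> K" "r \<notin> \<rat>" by blast
    then show "\<exists>m. \<forall>k\<ge>m. \<forall>F. finite F \<and> x \<in> F \<longrightarrow> Inl (F, ladder (x, r) k) \<in> \<Union>\<K>"
      using fibred_openD(3)[of K x r] K by (meson UnionI)
  qed
  ultimately have "istopology fibred_open"
    by (simp add: istopology_def)
  then show ?thesis
    by (simp add: fibred_space_def topology_inverse')
qed

text \<open>No point of a line belongs to the set, so the conditions at line points hold vacuously.
  Each copy of the Pixley-Roy space is thus an open sheet.\<close>

lemma openin_sheet:
  assumes "openin pixley_roy V"
  shows "openin fibred_space (Inl ` (V \<times> {i}))"
  unfolding openin_fibred_space
proof (rule fibred_openI)
  fix j
  have *: "{F. Inl (F, j) \<in> Inl ` (V \<times> {i})} = (if j = i then V else {})"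
    by auto
  show "openin pixley_roy {F. Inl (F, j) \<in> Inl ` (V \<times> {i})}"
    unfolding * using assms by simp
qed auto

definition fibre :: "real \<Rightarrow> ((real set \<times> nat) + (real \<times> real)) set" where
  "fibre x = Inr ` ({x} \<times> \<rat>)"

text \<open>The condition linking lines to sheets concerns irrational points only, and any radius
  works among the rationals of one line.\<close>

lemma openin_fibre: "openin fibred_space (fibre x)"
  unfolding openin_fibred_space
proof (rule fibred_openI)
  have *: "{F. Inl (F, i) \<in> fibre x} = {}" for i
    by (auto simp: fibre_def)
  show "openin pixley_roy {F. Inl (F, i) \<in> fibre x}" for i
    unfolding * by simp
next
  fix y r assume "Inr (y, r) \<in> fibre x"
  then show "\<exists>e>0. \<forall>s\<in>\<rat>. \<bar>s - r\<bar> < e \<longrightarrow> Inr (y, s) \<in> fibre x"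
    by (intro exI[of _ 1]) (auto simp: fibre_def)
qed (auto simp: fibre_def)

text \<open>For rational \<open>r\<close> the second part is empty and \<open>spoke x r n\<close> is just an interval of rationals.\<close>

definition spoke :: "real \<Rightarrow> real \<Rightarrow> nat \<Rightarrow> ((real set \<times> nat) + (real \<times> real)) set" where
  "spoke x r n = Inr ` ({x} \<times> insert r {s \<in> \<rat>. \<bar>s - r\<bar> < inverse (Suc n)}) \<union>
     {Inl (F, ladder (x, r) k) | F k. finite F \<and> x \<in> F \<and> n \<le> k \<and> r \<notin> \<rat>}"

lemma Inl_in_spoke:
  "Inl (F, i) \<in> spoke x r n \<longleftrightarrow> finite F \<and> x \<in> F \<and> r \<notin> \<rat> \<and> (\<exists>k\<ge>n. i = ladder (x, r) k)"
  unfolding spoke_def by auto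

lemma Inr_in_spoke:
  "Inr (y, s) \<in> spoke x r n \<longleftrightarrow> y = x \<and> (s = r \<or> s \<in> \<rat> \<and> \<bar>s - r\<bar> < inverse (Suc n))"
  unfolding spoke_def by auto

lemma openin_spoke: "openin fibred_space (spoke x r n)"
  unfolding openin_fibred_space
proof (rule fibred_openI)
  fix i
  have "{F. Inl (F, i) \<in> spoke x r n} = (if r \<notin> \<rat> \<and> (\<exists>k\<ge>n. i = ladder (x, r) k) then pr_basic {x} UNIV else {})"
    by (auto simp: Inl_in_spoke pr_basic_def)
  then show "openin pixley_roy {F. Inl (F, i) \<in> spoke x r n}"
    by (simp add: openin_pr_basic)
next
  fix y s assume *: "Inr (y, s) \<in> spoke x r n"
  \<comment> \<open>The room left around \<open>s\<close> inside the interval; at the centre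
    \<open>s = r\<close> it is the full radius.\<close>
  define e where "e = inverse (real (Suc n)) - \<bar>s - r\<bar>"
  have "e > 0"
    using * by (auto simp: e_def Inr_in_spoke)
  moreover have "Inr (y, t) \<in> spoke x r n" if "t \<in> \<rat>" "\<bar>t - s\<bar> < e" for t
    using * that by (auto simp: e_def Inr_in_spoke)
  ultimately show "\<exists>e>0. \<forall>t\<in>\<rat>. \<bar>t - s\<bar> < e \<longrightarrow> Inr (y, t) \<in> spoke x r n"
    by blast
next
  fix y s assume "Inr (y, s) \<in> spoke x r n" "s \<notin> \<rat>"
  \<comment> \<open>The only possible irrational line point of a spoke is its centre, so the ladder
    condition has to be checked there alone.\<close>
  then have "y = x" "s = r" "r \<notin> \<rat>"
    by (auto simp: Inr_in_spoke)
  then show "\<exists>m. \<forall>k\<ge>m. \<forall>F. finite F \<and> y \<in> F \<longrightarrow> Inl (F, ladder (y, s) k) \<in> spoke x r n"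
    by (intro exI[of _ n]) (auto simp: Inl_in_spoke)
qed

text \<open>Spokes shrink as \<open>n\<close> grows, so one index beyond both the metric threshold
  \<open>l\<close> and the ladder threshold \<open>m\<close> suffices. Hence the spokes form a
  countable local base at a line point.\<close>

lemma spoke_subset:
  assumes "openin fibred_space W" "Inr (x, r) \<in> W"
  shows "\<exists>n. spoke x r n \<subseteq> W"
proof -
  have W: "fibred_open W"
    using assms(1) by (simp add: openin_fibred_space)
  obtain e where e: "e > 0" "\<And>s. s \<in> \<rat> \<Longrightarrow> \<bar>s - r\<bar> < e \<Longrightarrow> Inr (x, s) \<in> W"
    using fibred_openD(2)[OF W assms(2)] by blast
  obtain m where m: "\<And>k F. r \<notin> \<rat> \<Longrightarrow> k \<ge> m \<Longrightarrow> finite F \<Longrightarrow> x \<in> F \<Longrightarrow> Inl (F, ladder (x, r) k) \<in> W"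
    using fibred_openD(3)[OF W assms(2)] by blast
  obtain l where l: "inverse (real (Suc l)) < e"
    using reals_Archimedean[OF e(1)] by blast
  have "inverse (real (Suc (max l m))) \<le> inverse (real (Suc l))"
    by (intro le_imp_inverse_le) auto
  with l have n: "inverse (real (Suc (max l m))) < e" by linarith
  have "p \<in> W" if "p \<in> spoke x r (max l m)" for p
  proof (cases p)
    case (Inl z)
    obtain F i where "z = (F, i)" by fastforce
    with Inl that m show ?thesis
      by (auto simp: Inl_in_spoke)
  next
    case (Inr z)
    obtain y s where "z = (y, s)" by fastforce
    with Inr that have "y = x" "s = r \<or> s \<in> \<rat> \<and> \<bar>s - r\<bar> < inverse (real (Suc (max l m)))"
      by (simp_all only: Inr_in_spoke)
    with Inr \<open>z = (y, s)\<close> e(2)[of s] n assms(2) show ?thesis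
      by auto
  qed
  then show ?thesis by blast
qed

lemma spoke_self: "Inr (x, r) \<in> spoke x r n"
  by (simp add: Inr_in_spoke)

lemma topspace_fibred_space:
  "topspace fibred_space = Inl ` (topspace pixley_roy \<times> UNIV) \<union> range Inr"
proof (intro equalityI subsetI)
  fix p assume p: "p \<in> topspace fibred_space"
  show "p \<in> Inl ` (topspace pixley_roy \<times> UNIV) \<union> range Inr"
  proof (cases p)
    case (Inl z)
    obtain F i where z: "z = (F, i)" by fastforce
    have "openin pixley_roy {F. Inl (F, i) \<in> topspace fibred_space}"
      by (rule fibred_openD) (simp flip: openin_fibred_space)
    then have "F \<in> topspace pixley_roy"
      using openin_subset p Inl z by blast
    with Inl z show ?thesis by auto
  qed auto
next
  fix p :: "(real set \<times> nat) + (real \<times> real)"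
  assume "p \<in> Inl ` (topspace pixley_roy \<times> UNIV) \<union> range Inr"
  then consider F i where "p = Inl (F, i)" "F \<in> topspace pixley_roy" | x r where "p = Inr (x, r)"
    by fastforce
  then show "p \<in> topspace fibred_space"
  proof cases
    case 1
    then show ?thesis
      using openin_subset[OF openin_sheet[OF openin_topspace]] by blast
  next
    case 2
    then show ?thesis
      using openin_subset[OF openin_spoke] spoke_self by blast
  qed
qed

lemma fibred_space_cases:
  assumes "p \<in> topspace fibred_space"
  obtains F i where "p = Inl (F, i)" "finite F" "F \<noteq> {}" | x r where "p = Inr (x, r)"
  using assms by (fastforce simp: topspace_fibred_space topspace_pixley_roy)

section \<open>First countability and the Hausdorff property of the fibred space\<close>

lemma first_countable_fibred_space: "first_countable fibred_space"
  unfolding first_countable_def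
proof
  fix p assume "p \<in> topspace fibred_space"
  then show "\<exists>\<B>. countable \<B> \<and> (\<forall>V\<in>\<B>. openin fibred_space V) \<and>
      (\<forall>U. openin fibred_space U \<and> p \<in> U \<longrightarrow> (\<exists>V\<in>\<B>. p \<in> V \<and> V \<subseteq> U))"
  proof (cases rule: fibred_space_cases)
    case (1 F i)
    obtain \<B> where \<B>: "countable \<B>" "\<And>V. V \<in> \<B> \<Longrightarrow> openin pixley_roy V \<and> F \<in> V"
      "\<And>U. openin pixley_roy U \<Longrightarrow> F \<in> U \<Longrightarrow> \<exists>V\<in>\<B>. V \<subseteq> U"
      by (rule pr_basic_local_base[of F]) (rule that)
    show ?thesis
    proof (intro exI[of _ "(\<lambda>V. Inl ` (V \<times> {i})) ` \<B>"] conjI allI impI ballI)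
      show "countable ((\<lambda>V. Inl ` (V \<times> {i})) ` \<B>)"
        using \<B>(1) by simp
      show "openin fibred_space W" if "W \<in> (\<lambda>V. Inl ` (V \<times> {i})) ` \<B>" for W
        using that \<B>(2) openin_sheet by auto
      fix U assume U: "openin fibred_space U \<and> p \<in> U"
      then have "openin pixley_roy {F. Inl (F, i) \<in> U}"
        by (intro fibred_openD(1)) (simp add: openin_fibred_space)
      then obtain V where V: "V \<in> \<B>" "V \<subseteq> {F. Inl (F, i) \<in> U}"
        using \<B>(3)[of "{F. Inl (F, i) \<in> U}"] U 1(1) by auto
      then have "Inl ` (V \<times> {i}) \<subseteq> U" "p \<in> Inl ` (V \<times> {i})"
        using \<B>(2) 1(1) by auto
      with V(1) show "\<exists>W\<in>(\<lambda>V. Inl ` (V \<times> {i})) ` \<B>. p \<in> W \<and> W \<subseteq> U"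
        by blast
    qed
  next
    case (2 x r)
    show ?thesis
    proof (intro exI[of _ "range (spoke x r)"] conjI allI impI ballI)
      fix U assume "openin fibred_space U \<and> p \<in> U"
      then obtain n where "spoke x r n \<subseteq> U"
        using spoke_subset 2 by blast
      then show "\<exists>V\<in>range (spoke x r). p \<in> V \<and> V \<subseteq> U"
        using 2 spoke_self by blast
    qed (use openin_spoke in auto)
  qed
qed

lemma openin_full_sheet: "openin fibred_space (Inl ` (topspace pixley_roy \<times> {i}))"
  by (intro openin_sheet openin_topspace)

lemma Hausdorff_fibred_space: "Hausdorff_space fibred_space"
proof -
  define sep where "sep p q \<longleftrightarrow> (\<exists>U V. openin fibred_space U \<and> openin fibred_space V \<and>
    p \<in> U \<and> q \<in> V \<and> disjnt U V)" for p q
  have sym: "sep p q \<Longrightarrow> sep q p" for p q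
    unfolding sep_def using disjnt_sym by metis
  have sheet: "sep (Inl (F, i)) (Inl (G, j))"
    if FG: "finite F" "F \<noteq> {}" "finite G" "G \<noteq> {}" "(F, i) \<noteq> (G, j)" for F G i j
  proof (cases "i = j")
    case True
    then obtain U V where "openin pixley_roy U" "openin pixley_roy V" "F \<in> U" "G \<in> V" "disjnt U V"
      using Hausdorff_pixley_roy[unfolded Hausdorff_space_def, rule_format, of F G] FG
      by (auto simp: topspace_pixley_roy)
    then show ?thesis
      unfolding sep_def using True
      by (intro exI[of _ "Inl ` (U \<times> {i})"] exI[of _ "Inl ` (V \<times> {j})"])
        (auto simp: openin_sheet disjnt_iff)
  next
    case False
    then have "disjnt (Inl ` (topspace pixley_roy \<times> {i})) (Inl ` (topspace pixley_roy \<times> {j}))"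
      by (auto simp: disjnt_iff)
    moreover have "F \<in> topspace pixley_roy" "G \<in> topspace pixley_roy"
      using FG by (auto simp: topspace_pixley_roy)
    ultimately show ?thesis
      unfolding sep_def using openin_full_sheet by blast
  qed
  have mixed: "sep (Inl (F, i)) (Inr (x, r))" if F: "finite F" "F \<noteq> {}" for F i x r
  proof -
    \<comment> \<open>A ladder takes each value at most once, so it eventually leaves sheet
      \<open>i\<close>; a late spoke then misses that sheet.\<close>
    have "\<exists>n. \<forall>k\<ge>n. i \<noteq> ladder (x, r) k"
      using ladder_eq_imp_level_eq by (metis Suc_n_not_le_n)
    then obtain n where "\<forall>k\<ge>n. i \<noteq> ladder (x, r) k" ..
    then have "disjnt (Inl ` (topspace pixley_roy \<times> {i})) (spoke x r n)"
      by (auto simp: disjnt_iff Inl_in_spoke)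
    then show ?thesis
      unfolding sep_def using F openin_full_sheet openin_spoke spoke_self
      by (intro exI[of _ "Inl ` (topspace pixley_roy \<times> {i})"] exI[of _ "spoke x r n"])
        (auto simp: topspace_pixley_roy)
  qed
  have fibres: "sep (Inr (x, r)) (Inr (y, s))" if ne: "(x, r) \<noteq> (y, s)" for x r y s
  proof -
    obtain m where m: "\<And>k l. k \<ge> m \<Longrightarrow> l \<ge> m \<Longrightarrow> ladder (x, r) k \<noteq> ladder (y, s) l"
      using ladder_eventually_differ[OF ne] by blast
    \<comment> \<open>On a common line the two intervals must be disjoint too, hence a radius below
      half the distance. On different lines any \<open>l\<close> will do.\<close>
    obtain l where l: "x = y \<Longrightarrow> inverse (real (Suc l)) < \<bar>r - s\<bar> / 2"
      using reals_Archimedean[of "\<bar>r - s\<bar> / 2"] ne by (cases "x = y") auto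
    have "inverse (real (Suc (max l m))) \<le> inverse (real (Suc l))"
      by (intro le_imp_inverse_le) auto
    with l have n: "x = y \<Longrightarrow> inverse (real (Suc (max l m))) < \<bar>r - s\<bar> / 2" by linarith
    have "False" if p: "p \<in> spoke x r (max l m)" "p \<in> spoke y s (max l m)" for p
    proof (cases p)
      case (Inl z)
      obtain F i where "z = (F, i)" by fastforce
      with Inl p obtain k k' where "k \<ge> m" "k' \<ge> m" "ladder (x, r) k = ladder (y, s) k'"
        by (auto simp: Inl_in_spoke)
      with m show ?thesis by blast
    next
      case (Inr z)
      obtain u t where z: "z = (u, t)" by fastforce
      have "x = y" "t = r \<or> \<bar>t - r\<bar> < inverse (real (Suc (max l m)))"
        "t = s \<or> \<bar>t - s\<bar> < inverse (real (Suc (max l m)))"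
        using p unfolding Inr z Inr_in_spoke by auto
      moreover have "0 < inverse (real (Suc (max l m)))" by simp
      ultimately show ?thesis using n ne by auto
    qed
    then have "disjnt (spoke x r (max l m)) (spoke y s (max l m))"
      by (auto simp: disjnt_iff)
    then show ?thesis
      unfolding sep_def
      by (intro exI[of _ "spoke x r (max l m)"] exI[of _ "spoke y s (max l m)"] conjI
          openin_spoke spoke_self)
  qed
  show ?thesis
    unfolding Hausdorff_space_def
  proof (intro allI impI, elim conjE)
    fix p q assume p: "p \<in> topspace fibred_space" and q: "q \<in> topspace fibred_space" and "p \<noteq> q"
    have "sep p q"
      using p
    proof (cases rule: fibred_space_cases)
      case p: (1 F i)
      from q show ?thesis
      proof (cases rule: fibred_space_cases)
        case q: (1 G j)
        show ?thesis
          unfolding p(1) q(1) by (rule sheet) (use p q \<open>p \<noteq> q\<close> in auto)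
      next
        case q: (2 y s)
        show ?thesis
          unfolding p(1) q(1) by (rule mixed) (use p in auto)
      qed
    next
      case p: (2 x r)
      from q show ?thesis
      proof (cases rule: fibred_space_cases)
        case q: (1 G j)
        show ?thesis
          unfolding p(1) q(1) by (rule sym, rule mixed) (use q in auto)
      next
        case q: (2 y s)
        show ?thesis
          unfolding p(1) q(1) by (rule fibres) (use p q \<open>p \<noteq> q\<close> in auto)
      qed
    qed
    then show "\<exists>U V. openin fibred_space U \<and> openin fibred_space V \<and> p \<in> U \<and> q \<in> V \<and> disjnt U V"
      by (simp add: sep_def)
  qed
qed

section \<open>Stars and discrete families in the fibred space\<close>

lemma in_starE:
  assumes "p \<in> star A \<U>"
  obtains U where "U \<in> \<U>" "U \<inter> A \<noteq> {}" "p \<in> U"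
proof -
  from assms obtain U where "U \<in> {U \<in> \<U>. U \<inter> A \<noteq> {}}" "p \<in> U"
    unfolding star_def by (rule UnionE)
  then show thesis
    by (intro that[of U]) simp_all
qed

lemma spoke_Inl:
  assumes "r \<notin> \<rat>"
  shows "Inl ({x}, ladder (x, r) n) \<in> spoke x r n"
  unfolding Inl_in_spoke using assms by (intro conjI exI[of _ n]) simp_all

text \<open>The linked classes of the Pixley-Roy space are now indexed by an upper bound together
  with a sheet number. With countably many sheets the index set stays countable; members without
  sheet points are left out of the claim.\<close>

lemma countable_subfamily_dense_in_sheets:
  assumes \<U>: "\<And>U. U \<in> \<U> \<Longrightarrow> openin fibred_space U"
  obtains \<V> where "countable \<V>" "\<V> \<subseteq> \<U>"
    "\<And>U z. U \<in> \<U> \<Longrightarrow> Inl z \<in> U \<Longrightarrow> U \<inter> \<Union>\<V> \<noteq> {}"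
proof -
  obtain \<C> :: "real set set" where \<C>: "countable \<C>" "\<And>W. W \<in> \<C> \<Longrightarrow> open W"
    "\<And>F U. finite F \<Longrightarrow> open U \<Longrightarrow> F \<subseteq> U \<Longrightarrow> \<exists>W\<in>\<C>. F \<subseteq> W \<and> W \<subseteq> U"
    by (rule countable_finite_interpolation) (rule that)
  define \<S> where "\<S> = {U \<in> \<U>. \<exists>z. Inl z \<in> U}"
  define P where "P j U \<longleftrightarrow> (\<exists>F. finite F \<and> F \<subseteq> fst j \<and>
      pr_basic F (fst j) \<subseteq> {G. Inl (G, snd j) \<in> U})"
    for j :: "real set \<times> nat" and U :: "((real set \<times> nat) + (real \<times> real)) set"
  have "\<exists>\<V>. countable \<V> \<and> \<V> \<subseteq> \<S> \<and> (\<forall>U\<in>\<S>. U \<inter> \<Union>\<V> \<noteq> {})"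
  proof (rule countable_subfamily_meeting_all[where J = "\<C> \<times> UNIV" and P = P])
    show "countable (\<C> \<times> (UNIV :: nat set))"
      using \<C>(1) by simp
  next
    fix U assume "U \<in> \<S>"
    then obtain F i where "U \<in> \<U>" and F: "Inl (F, i) \<in> U"
      by (auto simp: \<S>_def)
    then have "openin pixley_roy {G. Inl (G, i) \<in> U}"
      using \<U> by (intro fibred_openD(1)) (simp flip: openin_fibred_space)
    moreover have "F \<in> {G. Inl (G, i) \<in> U}" using F by simp
    ultimately obtain U' where U': "finite F" "F \<noteq> {}" "open U'" "F \<subseteq> U'"
      "pr_basic F U' \<subseteq> {G. Inl (G, i) \<in> U}"
      by (rule openin_pixley_royE)
    then obtain W where W: "W \<in> \<C>" "F \<subseteq> W" "W \<subseteq> U'"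
      using \<C>(3) by meson
    have "pr_basic F W \<subseteq> {G. Inl (G, i) \<in> U}"
      using pr_basic_mono[OF W(3)] U'(5) by (rule subset_trans)
    with U'(1) W(2) have "P (W, i) U"
      unfolding P_def fst_conv snd_conv by (intro exI[of _ F] conjI)
    with W(1) show "\<exists>j\<in>\<C> \<times> UNIV. P j U" by blast
  next
    fix j U V assume "P j U" "P j V"
    then obtain F G where "finite F" "F \<subseteq> fst j" "pr_basic F (fst j) \<subseteq> {G. Inl (G, snd j) \<in> U}"
      "finite G" "G \<subseteq> fst j" "pr_basic G (fst j) \<subseteq> {G. Inl (G, snd j) \<in> V}"
      unfolding P_def by meson
    then have "Inl (F \<union> G, snd j) \<in> U \<inter> V"
      using pr_basic_linked[of F "fst j" G] by blast
    then show "U \<inter> V \<noteq> {}" by blast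
  qed
  then obtain \<V> where "countable \<V>" "\<V> \<subseteq> \<S>" "\<forall>U\<in>\<S>. U \<inter> \<Union>\<V> \<noteq> {}"
    by (elim exE conjE) (rule that)
  then show ?thesis
    by (intro that[of \<V>]) (auto simp: \<S>_def)
qed

lemma exists_irrational_near:
  fixes r e :: real
  assumes "0 < e"
  obtains s where "s \<notin> \<rat>" "\<bar>s - r\<bar> < e"
proof -
  have "uncountable {r<..<r + e}"
    using assms by (simp add: uncountable_open_interval)
  then have "\<not> {r<..<r + e} \<subseteq> \<rat>"
    using countable_rat countable_subset by blast
  then obtain s where "s \<in> {r<..<r + e}" "s \<notin> \<rat>" by blast
  then show ?thesis by (intro that[of s]) auto
qed

lemma exists_rational_near:
  fixes r e :: real
  assumes "0 < e"
  obtains s where "s \<in> \<rat>" "\<bar>s - r\<bar> < e"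
proof -
  obtain s where "s \<in> \<rat>" "r < s" "s < r + e"
    using Rats_dense_in_real[of r "r + e"] assms by auto
  then show ?thesis by (intro that[of s]) auto
qed

lemma star_Lindelof_2_fibred_space: "star_Lindelof 2 fibred_space"
  unfolding star_Lindelof_def
proof (intro allI impI)
  fix \<U> assume "open_cover fibred_space \<U>"
  then have \<U>: "\<And>U. U \<in> \<U> \<Longrightarrow> openin fibred_space U" "\<Union>\<U> = topspace fibred_space"
    by (auto simp: open_cover_def)
  obtain \<V> where \<V>: "countable \<V>" "\<V> \<subseteq> \<U>"
    "\<And>U z. U \<in> \<U> \<Longrightarrow> Inl z \<in> U \<Longrightarrow> U \<inter> \<Union>\<V> \<noteq> {}"
    by (rule countable_subfamily_dense_in_sheets[OF \<U>(1)]) (assumption, rule that)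
  have near: "U \<subseteq> star (\<Union>\<V>) \<U>" if "U \<in> \<U>" "Inl z \<in> U" for U z
    using \<V>(3)[OF that] that(1) unfolding star_def by blast
  have "p \<in> star (star (\<Union>\<V>) \<U>) \<U>" if "p \<in> \<Union>\<U>" for p
  proof -
    from that obtain U where U: "U \<in> \<U>" "p \<in> U" by blast
    have "U \<inter> star (\<Union>\<V>) \<U> \<noteq> {}"
    proof (cases p)
      case (Inl z)
      with U near show ?thesis by blast
    next
      case (Inr z)
      obtain x r where p: "p = Inr (x, r)" using Inr by (cases z) auto
      obtain n where n: "spoke x r n \<subseteq> U"
        using spoke_subset \<U>(1) U p by blast
      \<comment> \<open>A rational \<open>r\<close> may have a neighbourhood that misses all sheets,
        so the path to the sheets goes through a nearby irrational \<open>s\<close>, whose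
        neighbourhoods always reach them.\<close>
      obtain s where s: "s \<notin> \<rat>" "\<bar>s - r\<bar> < inverse (Suc n)"
        by (rule exists_irrational_near[of "inverse (Suc n)" r]) auto
      have "Inr (x, s) \<in> \<Union>\<U>"
        by (simp add: \<U>(2) topspace_fibred_space)
      then obtain U' where U': "U' \<in> \<U>" "Inr (x, s) \<in> U'" by blast
      obtain m where m: "spoke x s m \<subseteq> U'"
        using spoke_subset \<U>(1) U' by blast
      then have "U' \<subseteq> star (\<Union>\<V>) \<U>"
        using near[OF U'(1)] spoke_Inl[OF s(1), of x m] by blast
      \<comment> \<open>The rational \<open>q\<close> is a common point of \<open>U\<close> and
        \<open>U'\<close>: the second bound keeps it within the radius of the spoke at
        \<open>r\<close> by the triangle inequality.\<close>
      moreover obtain q where q: "q \<in> \<rat>" "\<bar>q - s\<bar> < min (inverse (Suc m)) (inverse (Suc n) - \<bar>s - r\<bar>)"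
        by (rule exists_rational_near[of "min (inverse (Suc m)) (inverse (Suc n) - \<bar>s - r\<bar>)" s])
          (use s in auto)
      then have "\<bar>q - s\<bar> < inverse (Suc m)" "\<bar>q - r\<bar> < inverse (Suc n)"
        by auto
      with q(1) have "Inr (x, q) \<in> spoke x s m" "Inr (x, q) \<in> spoke x r n"
        by (simp_all only: Inr_in_spoke simp_thms)
      ultimately show ?thesis
        using m n by blast
    qed
    with U show ?thesis unfolding star_def by blast
  qed
  then have "star (star (\<Union>\<V>) \<U>) \<U> = \<Union>\<U>"
    by (intro equalityI subsetI) (auto simp: star_def)
  then show "\<exists>\<V>. countable \<V> \<and> \<V> \<subseteq> \<U> \<and> iter_star 2 (\<Union>\<V>) \<U> = topspace fibred_space"
    using \<V>(1,2) \<U>(2) by (intro exI[of _ \<V>]) (simp add: numeral_2_eq_2)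
qed

text \<open>The fibres are the discrete family: a sheet meets none of them, and a spoke over
  \<open>x\<close> only the fibre of \<open>x\<close>.\<close>

lemma not_DCCC_fibred_space: "\<not> DCCC fibred_space"
proof -
  have "inj fibre"
    by (intro injI) (auto simp: fibre_def)
  then have "uncountable (range fibre)"
    using uncountable_UNIV_real countable_image_inj_on by blast
  moreover have "openin fibred_space A \<and> A \<noteq> {}" if "A \<in> range fibre" for A
    using that openin_fibre by (auto simp: fibre_def)
  moreover have "discrete_family fibred_space (range fibre)"
    unfolding discrete_family_def
  proof
    fix p assume "p \<in> topspace fibred_space"
    then show "\<exists>V. openin fibred_space V \<and> p \<in> V \<and>
        (\<forall>A\<in>range fibre. \<forall>B\<in>range fibre. V \<inter> A \<noteq> {} \<and> V \<inter> B \<noteq> {} \<longrightarrow> A = B)"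
    proof (cases rule: fibred_space_cases)
      case (1 F i)
      have "Inl ` (topspace pixley_roy \<times> {i}) \<inter> fibre x = {}" for x
        by (auto simp: fibre_def)
      moreover have "p \<in> Inl ` (topspace pixley_roy \<times> {i})"
        using 1 by (auto simp: topspace_pixley_roy)
      ultimately show ?thesis
        using openin_full_sheet[of i] by (intro exI[of _ "Inl ` (topspace pixley_roy \<times> {i})"]) auto
    next
      case (2 x r)
      have "y = x" if "spoke x r 0 \<inter> fibre y \<noteq> {}" for y
        using that by (auto simp: fibre_def Inr_in_spoke)
      then show ?thesis
        using 2 openin_spoke[of x r 0] spoke_self[of x r 0]
        by (intro exI[of _ "spoke x r 0"]) auto
    qed
  qed
  ultimately show ?thesis
    unfolding DCCC_def by (intro notI) blast
qed

text \<open>The reals on which a point depends, so that one measure argument treats sheets and lines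
  alike.\<close>

fun support :: "(real set \<times> nat) + (real \<times> real) \<Rightarrow> real set" where
  "support (Inl (F, i)) = F"
| "support (Inr (x, r)) = {x}"

lemma support_spoke:
  assumes "p \<in> spoke x r n"
  shows "x \<in> support p"
  using assms by (cases p rule: support.cases) (simp_all add: Inl_in_spoke Inr_in_spoke)

lemma support_fibre:
  assumes "p \<in> fibre x"
  shows "support p = {x}"
  using assms unfolding fibre_def by auto

text \<open>On a sheet, the upper bound of an interval is cut down to a small open set around
  \<open>F\<close>. On a line, \<open>V\<close> is cut down to its rational points over
  \<open>x\<close>; density makes this nonempty, and all supports become the single point
  \<open>x\<close>.\<close>

lemma fibred_space_small_support:
  assumes V: "openin fibred_space V" "V \<noteq> {}" and "0 < e"
  shows "\<exists>W\<subseteq>V. openin fibred_space W \<and> W \<noteq> {} \<and>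
    (\<exists>U. open U \<and> emeasure lborel U \<le> ennreal e \<and> (\<forall>p\<in>W. support p \<subseteq> U))"
proof -
  have open_V: "fibred_open V"
    using V(1) by (simp add: openin_fibred_space)
  obtain p where p: "p \<in> V" "p \<in> topspace fibred_space"
    using V openin_subset by blast
  from p(2) show ?thesis
  proof (cases rule: fibred_space_cases)
    case (1 F i)
    then have "F \<in> {G. Inl (G, i) \<in> V}"
      using p(1) by simp
    with fibred_openD(1)[OF open_V, of i]
    obtain U where U: "finite F" "F \<noteq> {}" "open U" "F \<subseteq> U" "pr_basic F U \<subseteq> {G. Inl (G, i) \<in> V}"
      by (rule openin_pixley_royE)
    obtain T where T: "open T" "F \<subseteq> T" "emeasure lborel T \<le> ennreal e"
      using small_open_superset[OF U(1) \<open>0 < e\<close>] by blast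
    define B where "B = pr_basic F (U \<inter> T)"
    have B: "openin pixley_roy B" "F \<in> B"
      using U T unfolding B_def by (auto intro!: openin_pr_basic) (simp add: pr_basic_def)
    have "B \<subseteq> {G. Inl (G, i) \<in> V}"
      using pr_basic_mono[of "U \<inter> T" U F] U(5) by (simp add: B_def)
    then have "Inl ` (B \<times> {i}) \<subseteq> V"
      by auto
    moreover have "openin fibred_space (Inl ` (B \<times> {i}))" "Inl ` (B \<times> {i}) \<noteq> {}"
      using B openin_sheet by auto
    moreover have "\<forall>p\<in>Inl ` (B \<times> {i}). support p \<subseteq> T"
      by (auto simp: B_def pr_basic_def)
    ultimately show ?thesis
      using T by blast
  next
    case (2 x r)
    then obtain d where "d > 0" and d: "\<forall>s\<in>\<rat>. \<bar>s - r\<bar> < d \<longrightarrow> Inr (x, s) \<in> V"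
      using fibred_openD(2)[OF open_V] p(1) by meson
    obtain s where "s \<in> \<rat>" "\<bar>s - r\<bar> < d"
      by (rule exists_rational_near[OF \<open>d > 0\<close>])
    with d have "Inr (x, s) \<in> V \<inter> fibre x"
      by (auto simp: fibre_def)
    moreover have "openin fibred_space (V \<inter> fibre x)"
      using V(1) openin_fibre by (rule openin_Int)
    moreover obtain T where "open T" "{x} \<subseteq> T" "emeasure lborel T \<le> ennreal e"
      using small_open_superset[of "{x}" e] \<open>0 < e\<close> by auto
    moreover from this have "\<forall>p\<in>V \<inter> fibre x. support p \<subseteq> T"
      using support_fibre by auto
    ultimately show ?thesis by blast
  qed
qed

text \<open>Every irrational \<open>r\<close> gets a spoke avoiding \<open>0\<close>, so \<open>(x, 0)\<close> is covered by its fibre only.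
  That fibre meets just the spokes over \<open>x\<close>, and none of these meets a set
  whose points have supports without \<open>x\<close>.\<close>

lemma not_selectively_star_ccc_fibred_space: "\<not> selectively_star_ccc 2 fibred_space"
proof
  assume sel: "selectively_star_ccc 2 fibred_space"
  obtain \<A> where \<A>: "\<And>n::nat. maximal_disjoint_open_family fibred_space (\<A> n)"
    "\<And>A. (\<And>n. A n \<in> \<A> n) \<Longrightarrow> \<exists>x. \<forall>p\<in>\<Union>n. A n. x \<notin> support p"
    using exists_unselectable_families[OF fibred_space_small_support] by blast
  define \<U> where "\<U> = range (\<lambda>i. Inl ` (topspace pixley_roy \<times> {i})) \<union> range fibre \<union>
    {spoke x r n | x r n. r \<notin> \<rat> \<and> inverse (Suc n) < \<bar>r\<bar>}"
  \<comment> \<open>Members touching the line of \<open>x\<close> lie over \<open>x\<close>. This is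
    used once for the point at 0 and once for the fibre point reached by the first star.\<close>
  have cover_cases: "U = fibre x \<or> (\<exists>r n. U = spoke x r n \<and> r \<notin> \<rat> \<and> inverse (Suc n) < \<bar>r\<bar>)"
    if "U \<in> \<U>" "Inr (x, s) \<in> U" for U x s
  proof -
    from that(1) consider i where "U = Inl ` (topspace pixley_roy \<times> {i})" | y where "U = fibre y"
      | y r n where "U = spoke y r n" "r \<notin> \<rat>" "inverse (Suc n) < \<bar>r\<bar>"
      unfolding \<U>_def by blast
    then show ?thesis
    proof cases
      case 1
      then show ?thesis using that(2) by auto
    next
      case 2
      then show ?thesis using that(2) by (auto simp: fibre_def)
    next
      case 3
      then have "x = y" using that(2) by (simp add: Inr_in_spoke)
      then show ?thesis using 3 by blast
    qed
  qed
  have sheet_in: "Inl ` (topspace pixley_roy \<times> {i}) \<in> \<U>" for i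
    by (simp add: \<U>_def)
  have fibre_in: "fibre x \<in> \<U>" for x
    by (simp add: \<U>_def)
  have spoke_in: "spoke x r n \<in> \<U>" if "r \<notin> \<rat>" "inverse (Suc n) < \<bar>r\<bar>" for x r n
    unfolding \<U>_def using that by (intro UnI2 CollectI exI[of _ x] exI[of _ r] exI[of _ n]) simp
  have "open_cover fibred_space \<U>"
    unfolding open_cover_def
  proof
    show op: "\<forall>U\<in>\<U>. openin fibred_space U"
      using openin_full_sheet openin_fibre openin_spoke by (auto simp: \<U>_def)
    show "\<Union>\<U> = topspace fibred_space"
    proof (intro equalityI subsetI)
      fix p assume "p \<in> \<Union>\<U>"
      then show "p \<in> topspace fibred_space"
        using op openin_subset by blast
    next
      fix p assume "p \<in> topspace fibred_space"
      then show "p \<in> \<Union>\<U>"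
      proof (cases rule: fibred_space_cases)
        case (1 F i)
        then have "p \<in> Inl ` (topspace pixley_roy \<times> {i})"
          by (auto simp: topspace_pixley_roy)
        then show ?thesis using sheet_in by (rule UnionI[rotated])
      next
        case (2 x r)
        show ?thesis
        proof (cases "r \<in> \<rat>")
          case True
          then have "p \<in> fibre x" using 2 by (auto simp: fibre_def)
          then show ?thesis using fibre_in by (rule UnionI[rotated])
        next
          case False
          \<comment> \<open>An irrational \<open>r\<close> is not 0, so some radius is small enough
            for its spoke to avoid 0.\<close>
          then have "0 < \<bar>r\<bar>" by auto
          then obtain n where "inverse (real (Suc n)) < \<bar>r\<bar>"
            using reals_Archimedean[of "\<bar>r\<bar>"] by blast
          with False have "spoke x r n \<in> \<U>"
            by (intro spoke_in) auto
          then show ?thesis using 2 spoke_self by (intro UnionI) auto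
        qed
      qed
    qed
  qed
  then obtain A where A: "\<And>n. A n \<in> \<A> n"
    "iter_star 2 (\<Union>n. A n) \<U> = topspace fibred_space"
    using sel[unfolded selectively_star_ccc_def, rule_format, of \<U> \<A>] \<A>(1) by auto
  obtain x where x: "\<forall>p\<in>\<Union>n. A n. x \<notin> support p"
    using \<A>(2)[OF A(1)] by blast
  have "Inr (x, 0) \<in> star (star (\<Union>n. A n) \<U>) \<U>"
    using A(2) by (simp add: numeral_2_eq_2 topspace_fibred_space)
  then obtain U where U: "U \<in> \<U>" "U \<inter> star (\<Union>n. A n) \<U> \<noteq> {}" "Inr (x, 0) \<in> U"
    by (rule in_starE)
  have "Inr (x, 0) \<notin> spoke x r n" if "r \<notin> \<rat>" "inverse (Suc n) < \<bar>r\<bar>" for r n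
    using that by (auto simp: Inr_in_spoke)
  then have "U = fibre x"
    using cover_cases[OF U(1,3)] U(3) by blast
  with U(2) obtain p where p: "p \<in> fibre x" "p \<in> star (\<Union>n. A n) \<U>"
    by blast
  from p(1) obtain q where "p = Inr (x, q)"
    by (auto simp: fibre_def)
  with p(2) have "Inr (x, q) \<in> star (\<Union>n. A n) \<U>"
    by simp
  then obtain U' where U': "U' \<in> \<U>" "U' \<inter> (\<Union>n. A n) \<noteq> {}" "Inr (x, q) \<in> U'"
    by (rule in_starE)
  \<comment> \<open>\<open>U'\<close> contains a point of the line of \<open>x\<close>, so all its
    supports contain \<open>x\<close>; yet it meets the selection, whose supports all miss
    \<open>x\<close>.\<close>
  have "\<forall>p\<in>U'. x \<in> support p"
  proof -
    consider "U' = fibre x" | r n where "U' = spoke x r n"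
      using cover_cases[OF U'(1,3)] by blast
    then show ?thesis
      by cases (auto simp: support_fibre support_spoke)
  qed
  with U'(2) x show False by blast
qed

section \<open>Moving to the type of real sequences\<close>

lemma exists_inj_on_finite_real_sets:
  "\<exists>f :: real set \<Rightarrow> nat \<Rightarrow> real. inj_on f {F. finite F}"
proof (intro exI inj_onI)
  \<comment> \<open>Entry 0 stores the cardinality: lists of equal length are compared entry by
    entry, whatever \<open>!\<close> returns beyond their end.\<close>
  define f :: "real set \<Rightarrow> nat \<Rightarrow> real"
    where "f F = case_nat (real (card F)) (\<lambda>n. sorted_list_of_set F ! n)" for F
  fix F G :: "real set" assume *: "F \<in> {F. finite F}" "G \<in> {F. finite F}"
    and eq: "f F = f G"
  have "card F = card G"
    using fun_cong[OF eq, of 0] by (simp add: f_def)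
  moreover have "sorted_list_of_set F ! n = sorted_list_of_set G ! n" for n
    using fun_cong[OF eq, of "Suc n"] by (simp add: f_def)
  ultimately have "sorted_list_of_set F = sorted_list_of_set G"
    by (intro nth_equalityI) auto
  then show "F = G"
    using * by (metis mem_Collect_eq set_sorted_list_of_set)
qed

lemma exists_inj_on_fibred_space:
  "\<exists>g :: (real set \<times> nat) + (real \<times> real) \<Rightarrow> nat \<Rightarrow> real. inj_on g (topspace fibred_space)"
proof -
  obtain f :: "real set \<Rightarrow> nat \<Rightarrow> real" where f: "inj_on f {F. finite F}"
    using exists_inj_on_finite_real_sets by blast
  \<comment> \<open>Entry 0 tags the summand and entry 1 holds the sheet number or the line; the
    rest codes the finite set, or is constantly the point of the line.\<close>
  define g :: "(real set \<times> nat) + (real \<times> real) \<Rightarrow> nat \<Rightarrow> real"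
    where "g = case_sum (\<lambda>(F, i). case_nat 0 (case_nat (real i) (f F)))
      (\<lambda>(x, r). case_nat 1 (case_nat x (\<lambda>_. r)))"
  have eqD: "a = b \<and> h = k" if "case_nat a h = case_nat b k" for a b :: real and h k
    using fun_cong[OF that, of 0] fun_cong[OF that, of "Suc _"] by auto
  have "inj_on g (topspace fibred_space)"
  proof (rule inj_onI)
    fix p q assume p: "p \<in> topspace fibred_space" and q: "q \<in> topspace fibred_space"
      and eq: "g p = g q"
    from p show "p = q"
    proof (cases rule: fibred_space_cases)
      case p: (1 F i)
      from q show ?thesis
      proof (cases rule: fibred_space_cases)
        case q: (1 G j)
        have "case_nat (real i) (f F) = case_nat (real j) (f G)"
          using eqD[of 0 _ 0] eq p q by (simp add: g_def)
        then have "real i = real j" "f F = f G"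
          using eqD by blast+
        then show ?thesis
          using p q inj_onD[OF f] by auto
      qed (use eqD[of 0 _ 1] eq p in \<open>fastforce simp: g_def\<close>)
    next
      case p: (2 x r)
      from q show ?thesis
      proof (cases rule: fibred_space_cases)
        case q: (2 y s)
        have "case_nat x (\<lambda>_. r) = case_nat y (\<lambda>_. s)"
          using eqD[of 1 _ 1] eq p q by (simp add: g_def)
        then have "x = y" "(\<lambda>_::nat. r) = (\<lambda>_. s)"
          using eqD by blast+
        then show ?thesis
          using p q by (simp add: fun_eq_iff)
      qed (use eqD[of 1 _ 0] eq p in \<open>fastforce simp: g_def\<close>)
    qed
  qed
  then show ?thesis by blast
qed

(* HOL cannot quantify existentially over types, so the underlying sets are subsets of one
   fixed type of cardinality continuum.  The empty space is excluded because its only maximal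
   disjoint family is {}, which would make it fail selective star-ccc for a degenerate reason. *)
theorem mainTheorem2:
  shows "(\<exists>X :: (nat \<Rightarrow> real) topology.
            topspace X \<noteq> {} \<and> Hausdorff_space X \<and> first_countable X \<and>
            star_Lindelof 1 X \<and> \<not> selectively_star_ccc 1 X) \<and>
         (\<exists>Y :: (nat \<Rightarrow> real) topology.
            topspace Y \<noteq> {} \<and> Hausdorff_space Y \<and> first_countable Y \<and>
            star_Lindelof 2 Y \<and> \<not> selectively_star_ccc 2 Y \<and> \<not> DCCC Y)"
proof
  obtain f :: "real set \<Rightarrow> nat \<Rightarrow> real" where "inj_on f {F. finite F}"
    using exists_inj_on_finite_real_sets by blast
  then have "inj_on f (topspace pixley_roy)"
    by (rule inj_on_subset) (auto simp: topspace_pixley_roy)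
  then obtain X :: "(nat \<Rightarrow> real) topology"
    where X: "(pixley_roy :: real set topology) homeomorphic_space X"
    using homeomorphic_copy by blast
  have "{0} \<in> topspace (pixley_roy :: real set topology)"
    by (simp add: topspace_pixley_roy)
  then have "topspace X \<noteq> {}"
    using homeomorphic_empty_space[OF X] by (metis empty_iff null_topspace_iff_trivial)
  moreover have "Hausdorff_space X"
    using Hausdorff_pixley_roy homeomorphic_Hausdorff_space[OF X] by blast
  moreover have "first_countable X"
    using first_countable_pixley_roy first_countable_homeomorphic_space[OF X] by blast
  moreover have "star_Lindelof 1 X"
    using star_Lindelof_pixley_roy star_Lindelof_homeomorphic_space[OF X] by blast
  \<comment> \<open>Negative properties travel along the inverse homeomorphism: if the copy had the
    property, so would the original.\<close>
  moreover have "\<not> selectively_star_ccc 1 X"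
    using not_selectively_star_ccc_pixley_roy selectively_star_ccc_homeomorphic_space X
      homeomorphic_space_sym by blast
  ultimately show "\<exists>X :: (nat \<Rightarrow> real) topology.
            topspace X \<noteq> {} \<and> Hausdorff_space X \<and> first_countable X \<and>
            star_Lindelof 1 X \<and> \<not> selectively_star_ccc 1 X"
    by blast
next
  obtain g :: "(real set \<times> nat) + (real \<times> real) \<Rightarrow> nat \<Rightarrow> real"
    where "inj_on g (topspace fibred_space)"
    using exists_inj_on_fibred_space by blast
  then obtain Y :: "(nat \<Rightarrow> real) topology" where Y: "fibred_space homeomorphic_space Y"
    using homeomorphic_copy by blast
  have "topspace fibred_space \<noteq> {}"
    by (auto simp: topspace_fibred_space)
  then have "topspace Y \<noteq> {}"
    using homeomorphic_empty_space[OF Y] by (metis null_topspace_iff_trivial)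
  moreover have "Hausdorff_space Y"
    using Hausdorff_fibred_space homeomorphic_Hausdorff_space[OF Y] by blast
  moreover have "first_countable Y"
    using first_countable_fibred_space first_countable_homeomorphic_space[OF Y] by blast
  moreover have "star_Lindelof 2 Y"
    using star_Lindelof_2_fibred_space star_Lindelof_homeomorphic_space[OF Y] by blast
  moreover have "\<not> selectively_star_ccc 2 Y"
    using not_selectively_star_ccc_fibred_space selectively_star_ccc_homeomorphic_space Y
      homeomorphic_space_sym by blast
  moreover have "\<not> DCCC Y"
    using not_DCCC_fibred_space DCCC_homeomorphic_space Y homeomorphic_space_sym by blast
  ultimately show "\<exists>Y :: (nat \<Rightarrow> real) topology.
            topspace Y \<noteq> {} \<and> Hausdorff_space Y \<and> first_countable Y \<and>
            star_Lindelof 2 Y \<and> \<not> selectively_star_ccc 2 Y \<and> \<not> DCCC Y"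
    by blast
qed

end
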